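(* Let $A$ and $B$ be $C^{*}$-algebras, let $\varphi:A \to B$ be a completely positive contractive order zero map, and let $f \in \mathcal{C}_{0}((0,1])$ be a positive function. Set $C:=C^{*}(\varphi(A))\subset B$, and let $h \in \mathcal{M}(C) \cap C'$ be a positive element with $\|h\|=\|\varphi\|$ and $\pi_{\varphi}:A \to \mathcal{M}(C) \cap \{h\}'$ a $*$-homomorphism such that $\pi_{\varphi}(a)h=\varphi(a)$ for all $a\in A$ (with $h=\varphi(\mathbf{1}_A)$ if $A$ is unital). Then the map \[ f(\varphi): A \to C \subset B, \qquad f(\varphi)(a):= f(h) \pi_{\varphi}(a) \quad \text{for } a \in A, \] is a well-defined completely positive order zero map (in particular, $f(h)\pi_\varphi(a)\in C$ for all $a\in A$). If $f$ has norm at most one, then $f(\varphi)$ is also contractive.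
   Context: Two elements $a,b$ of a $C^{*}$-algebra are orthogonal, written $a \perp b$, if $ab=ba=a^{*}b=ab^{*}=0$. A completely positive map $\varphi:A\to B$ between $C^{*}$-algebras has order zero if, for all $a,b\in A_{+}$, $a\perp b$ implies $\varphi(a)\perp\varphi(b)$. $C^{*}(\varphi(A))$ denotes the $C^{*}$-subalgebra of $B$ generated by $\varphi(A)$; $\mathcal{M}(C)$ is the multiplier algebra of $C$; primes denote commutants. A pair $(h,\pi_{\varphi})$ as in the claim exists for every completely positive order zero map $\varphi$ (structure theorem for such maps). $\mathcal{C}_{0}((0,1])$ is the $C^{*}$-algebra of continuous complex-valued functions on $(0,1]$ vanishing at $0$, and $f(h)$ is defined by continuous functional calculus of the positive contraction $h$ (with $f(0)=0$). *)

theory Defs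
  imports "HOL-Analysis.Analysis"
begin

section \<open>\<open>C\<^sup>*\<close>-algebras\<close>

text \<open>Not necessarily unital, and possibly zero.\<close>

class cstar_algebra = real_normed_algebra + banach +
  fixes scaleC :: "complex \<Rightarrow> 'a \<Rightarrow> 'a"  (infixr \<open>*\<^sub>C\<close> 75)
    and adj :: "'a \<Rightarrow> 'a"
  assumes scaleC_add_right: "c *\<^sub>C (x + y) = c *\<^sub>C x + c *\<^sub>C y"
    and scaleC_add_left: "(c + d) *\<^sub>C x = c *\<^sub>C x + d *\<^sub>C x"
    and scaleC_scaleC: "c *\<^sub>C d *\<^sub>C x = (c * d) *\<^sub>C x"
    and scaleC_of_real: "complex_of_real r *\<^sub>C x = r *\<^sub>R x"
    and scaleC_mult_left: "(c *\<^sub>C x) * y = c *\<^sub>C (x * y)"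
    and scaleC_mult_right: "x * (c *\<^sub>C y) = c *\<^sub>C (x * y)"
    and norm_scaleC: "norm (c *\<^sub>C x) = cmod c * norm x"
    and adj_add: "adj (x + y) = adj x + adj y"
    and adj_scaleC: "adj (c *\<^sub>C x) = cnj c *\<^sub>C adj x"
    and adj_mult: "adj (x * y) = adj y * adj x"
    and adj_adj: "adj (adj x) = x"
    and cstar_identity: "norm (adj x * x) = (norm x)\<^sup>2"

definition cstar_subalgebra :: "'b::cstar_algebra set \<Rightarrow> bool" where
  "cstar_subalgebra S \<longleftrightarrow>
     closed S \<and> 0 \<in> S \<and>
     (\<forall>x\<in>S. \<forall>y\<in>S. x + y \<in> S \<and> x * y \<in> S) \<and>
     (\<forall>c. \<forall>x\<in>S. c *\<^sub>C x \<in> S) \<and>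
     (\<forall>x\<in>S. adj x \<in> S)"

definition cstar_generated :: "'b::cstar_algebra set \<Rightarrow> 'b set" where
  "cstar_generated X = cstar_subalgebra hull X"

text \<open>Throughout, in \<open>'a\<close>, in its matrix algebras and in multiplier algebras, the positive
  elements of a \<open>C\<^sup>*\<close>-algebra are those of the form \<open>y\<^sup>*y\<close> with \<open>y\<close> in that algebra.\<close>

definition positive :: "'a::cstar_algebra \<Rightarrow> bool" where
  "positive a \<longleftrightarrow> (\<exists>y. a = adj y * y)"

definition orthogonal_elems :: "'a::cstar_algebra \<Rightarrow> 'a \<Rightarrow> bool" where
  "orthogonal_elems a b \<longleftrightarrow> a * b = 0 \<and> b * a = 0 \<and> adj a * b = 0 \<and> a * adj b = 0"

definition clinear_on :: "'a::cstar_algebra set \<Rightarrow> ('a \<Rightarrow> 'b::cstar_algebra) \<Rightarrow> bool" where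
  "clinear_on S f \<longleftrightarrow>
     (\<forall>x\<in>S. \<forall>y\<in>S. f (x + y) = f x + f y) \<and> (\<forall>c. \<forall>x\<in>S. f (c *\<^sub>C x) = c *\<^sub>C f x)"


section \<open>Completely positive maps of order zero\<close>

text \<open>An \<open>n \<times> n\<close> matrix is a function of two indices of which only the values at
  indices below \<open>n\<close> matter. \<open>mat_positive S n a\<close> says that \<open>a\<close> is a positive element
  \<open>y\<^sup>*y\<close> of the \<open>C\<^sup>*\<close>-algebra \<open>M\<^sub>n(S)\<close>.\<close>

definition mat_positive ::
    "'a::cstar_algebra set \<Rightarrow> nat \<Rightarrow> (nat \<Rightarrow> nat \<Rightarrow> 'a) \<Rightarrow> bool" where
  "mat_positive S n a \<longleftrightarrow>
     (\<exists>y. (\<forall>i<n. \<forall>j<n. y i j \<in> S) \<and>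
          (\<forall>i<n. \<forall>j<n. a i j = (\<Sum>k<n. adj (y k i) * y k j)))"

text \<open>Complete positivity of a map into the \<open>C\<^sup>*\<close>-subalgebra \<open>S\<close> of \<open>'b\<close>: the
  square roots \<open>y\<close> of the image matrices are required to have entries in \<open>S\<close>, so complete
  positivity into \<open>S\<close> implies complete positivity into every larger subalgebra.\<close>

definition completely_positive ::
    "'b set \<Rightarrow> ('a::cstar_algebra \<Rightarrow> 'b::cstar_algebra) \<Rightarrow> bool" where
  "completely_positive S \<phi> \<longleftrightarrow>
     (\<forall>a. \<phi> a \<in> S) \<and> clinear_on UNIV \<phi> \<and>
     (\<forall>n a. mat_positive UNIV n a \<longrightarrow> mat_positive S n (\<lambda>i j. \<phi> (a i j)))"

definition order_zero :: "('a::cstar_algebra \<Rightarrow> 'b::cstar_algebra) \<Rightarrow> bool" where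
  "order_zero \<phi> \<longleftrightarrow>
     (\<forall>a b. positive a \<and> positive b \<and> orthogonal_elems a b
            \<longrightarrow> orthogonal_elems (\<phi> a) (\<phi> b))"

definition contractive :: "('a::cstar_algebra \<Rightarrow> 'b::cstar_algebra) \<Rightarrow> bool" where
  "contractive \<phi> \<longleftrightarrow> (\<forall>a. norm (\<phi> a) \<le> norm a)"


section \<open>The multiplier algebra\<close>

text \<open>The multiplier algebra of a \<open>C\<^sup>*\<close>-subalgebra \<open>C\<close> of \<open>'b\<close> is the
  \<open>C\<^sup>*\<close>-algebra of double centralizers \<open>(L, R)\<close> of \<open>C\<close>. The maps \<open>L\<close> and \<open>R\<close>
  live on \<open>C\<close> and are represented by functions on \<open>'b\<close> that are \<open>0\<close> off \<open>C\<close>; the operations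
  preserve this normalization, so that equality of double centralizers is equality of pairs.\<close>

type_synonym 'b centralizer = "('b \<Rightarrow> 'b) \<times> ('b \<Rightarrow> 'b)"

definition bounded_clinear_within :: "'b::cstar_algebra set \<Rightarrow> ('b \<Rightarrow> 'b) \<Rightarrow> bool" where
  "bounded_clinear_within C T \<longleftrightarrow>
     (\<forall>x\<in>C. T x \<in> C) \<and> (\<forall>x. x \<notin> C \<longrightarrow> T x = 0) \<and>
     clinear_on C T \<and> (\<exists>K. \<forall>x\<in>C. norm (T x) \<le> K * norm x)"

definition multipliers :: "'b::cstar_algebra set \<Rightarrow> 'b centralizer set" where
  "multipliers C =
     {(L, R). bounded_clinear_within C L \<and> bounded_clinear_within C R \<and>
        (\<forall>x\<in>C. \<forall>y\<in>C. L (x * y) = L x * y \<and> R (x * y) = x * R y \<and> R x * y = x * L y)}"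

definition M_add :: "'b::cstar_algebra centralizer \<Rightarrow> 'b centralizer \<Rightarrow> 'b centralizer" where
  "M_add m n = ((\<lambda>x. fst m x + fst n x), (\<lambda>x. snd m x + snd n x))"

definition M_scale :: "complex \<Rightarrow> 'b::cstar_algebra centralizer \<Rightarrow> 'b centralizer" where
  "M_scale c m = ((\<lambda>x. c *\<^sub>C fst m x), (\<lambda>x. c *\<^sub>C snd m x))"

definition M_mult :: "'b::cstar_algebra centralizer \<Rightarrow> 'b centralizer \<Rightarrow> 'b centralizer" where
  "M_mult m n = (fst m \<circ> fst n, snd n \<circ> snd m)"

definition M_adj :: "'b::cstar_algebra centralizer \<Rightarrow> 'b centralizer" where
  "M_adj m = ((\<lambda>x. adj (snd m (adj x))), (\<lambda>x. adj (fst m (adj x))))"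

text \<open>The operator norm of \<open>L\<close>, which is also that of \<open>R\<close>.\<close>

definition M_norm :: "'b::cstar_algebra set \<Rightarrow> 'b centralizer \<Rightarrow> real" where
  "M_norm C m = (SUP x\<in>C. norm (fst m x) / norm x)"

definition M_embed :: "'b::cstar_algebra set \<Rightarrow> 'b \<Rightarrow> 'b centralizer" where
  "M_embed C c = ((\<lambda>x. if x \<in> C then c * x else 0), (\<lambda>x. if x \<in> C then x * c else 0))"

definition M_positive :: "'b::cstar_algebra set \<Rightarrow> 'b centralizer \<Rightarrow> bool" where
  "M_positive C m \<longleftrightarrow> (\<exists>k\<in>multipliers C. m = M_mult (M_adj k) k)"

definition star_hom_multipliers ::
    "'b set \<Rightarrow> ('a::cstar_algebra \<Rightarrow> 'b::cstar_algebra centralizer) \<Rightarrow> bool" where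
  "star_hom_multipliers C \<pi> \<longleftrightarrow>
     (\<forall>a. \<pi> a \<in> multipliers C) \<and>
     (\<forall>a b. \<pi> (a + b) = M_add (\<pi> a) (\<pi> b)) \<and>
     (\<forall>c a. \<pi> (c *\<^sub>C a) = M_scale c (\<pi> a)) \<and>
     (\<forall>a b. \<pi> (a * b) = M_mult (\<pi> a) (\<pi> b)) \<and>
     (\<forall>a. \<pi> (adj a) = M_adj (\<pi> a))"


section \<open>Functional calculus\<close>

text \<open>Elements of \<open>C\<^sub>0((0,1])\<close> are extended by \<open>0\<close> to the real line; vanishing at
  \<open>0\<close> is then continuity of the extension on \<open>[0,1]\<close>. Addition, multiplication, scaling and
  conjugation are pointwise.\<close>

definition C0_01 :: "(real \<Rightarrow> complex) set" where
  "C0_01 = {f. continuous_on {0..1} f \<and> (\<forall>t. t \<notin> {0<..1} \<longrightarrow> f t = 0)}"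

definition id_01 :: "real \<Rightarrow> complex" where
  "id_01 t = (if t \<in> {0<..1} then complex_of_real t else 0)"

definition star_hom_C0_multipliers ::
    "'b set \<Rightarrow> ((real \<Rightarrow> complex) \<Rightarrow> 'b::cstar_algebra centralizer) \<Rightarrow> bool" where
  "star_hom_C0_multipliers C \<Phi> \<longleftrightarrow>
     (\<forall>f\<in>C0_01. \<Phi> f \<in> multipliers C) \<and>
     (\<forall>f\<in>C0_01. \<forall>g\<in>C0_01. \<Phi> (\<lambda>t. f t + g t) = M_add (\<Phi> f) (\<Phi> g)) \<and>
     (\<forall>c. \<forall>f\<in>C0_01. \<Phi> (\<lambda>t. c * f t) = M_scale c (\<Phi> f)) \<and>
     (\<forall>f\<in>C0_01. \<forall>g\<in>C0_01. \<Phi> (\<lambda>t. f t * g t) = M_mult (\<Phi> f) (\<Phi> g)) \<and>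
     (\<forall>f\<in>C0_01. \<Phi> (\<lambda>t. cnj (f t)) = M_adj (\<Phi> f))"

text \<open>For a positive contraction \<open>h\<close> of the multiplier algebra of \<open>C\<close> the functional
  calculus \<open>f \<mapsto> f(h)\<close> is the unique \<open>*\<close>-homomorphism on \<open>C\<^sub>0((0,1])\<close> that sends the
  identity function to \<open>h\<close>.\<close>

definition M_cfc ::
    "'b::cstar_algebra set \<Rightarrow> (real \<Rightarrow> complex) \<Rightarrow> 'b centralizer \<Rightarrow> 'b centralizer" where
  "M_cfc C f h = (THE m. \<exists>\<Phi>. star_hom_C0_multipliers C \<Phi> \<and> \<Phi> id_01 = h \<and> m = \<Phi> f)"

text \<open>The map \<open>a \<mapsto> f(h) \<pi>(a)\<close> with values in \<open>C\<close>. It is meaningful only when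
  \<open>f(h) \<pi>(a)\<close> lies in the image of \<open>C\<close> under the (injective) canonical embedding.\<close>

definition order_zero_calculus ::
    "'b set \<Rightarrow> (real \<Rightarrow> complex) \<Rightarrow> 'b centralizer \<Rightarrow> ('a::cstar_algebra \<Rightarrow> 'b::cstar_algebra centralizer)
      \<Rightarrow> 'a \<Rightarrow> 'b" where
  "order_zero_calculus C f h \<pi> a = inv_into C (M_embed C) (M_mult (M_cfc C f h) (\<pi> a))"

end

theory Submission
  imports Defs "HOL-Complex_Analysis.Complex_Analysis"
begin

text \<open>Everything rests on one device: for self-adjoint \<open>a\<close> with \<open>\<parallel>a\<parallel> < 1\<close>, the contraction principle
  gives \<open>b\<close> with \<open>(1 + b)\<^sup>2 = 1 - a\<^sup>2\<close>, so that \<open>a\<close> is the real part of the unitary \<open>a + i(1 + b)\<close>. Hence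
  \<open>*\<close>-homomorphisms are contractive, and a polynomial \<open>q(a)\<close> is a Laurent polynomial in a unitary
  whose coefficients are bounded by \<open>sup |q|\<close> on \<open>[-1,1]\<close>; applied to high powers of \<open>q\<close> this gives
  \<open>\<parallel>q(a)\<parallel> \<le> sup |q|\<close>, and the functional calculus on \<open>[-1,1]\<close> by the Weierstrass theorem.

  The element \<open>h = k\<^sup>*k\<close> is central in the multiplier algebra, which makes it elementary to show that
  its negative part vanishes. So the functional calculus of \<open>h\<close> on \<open>[-1,1]\<close> restricts to the one on
  \<open>C\<^sub>0((0,1])\<close>. Finally \<open>f(h) \<pi>(a) = p(h) \<phi>(a) \<in> C\<close> for \<open>f = t p(t)\<close>, hence \<open>f(h) \<pi>(a) \<in> C\<close> for all \<open>f\<close>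
  by density; and \<open>f(h) \<pi>(y\<^sup>*y) = (g(h) \<pi>(y))\<^sup>* (g(h) \<pi>(y))\<close> for \<open>g = \<surd>f\<close>.\<close>

section \<open>Elementary facts about \<open>C\<^sup>*\<close>-algebras\<close>

text \<open>No spectrum appears: positivity is available only as a factorisation
  \<open>adj y * y\<close>, so each positivity argument becomes a norm estimate.
  \<open>M_cfc\<close> is a definite description, hence a *-homomorphism on \<open>C0_01\<close>
  with value h at \<open>id_01\<close> must be shown to exist and to be determined on
  \<open>C0_01\<close>. Uniqueness: such a homomorphism is contractive, because the relation between
  a and b has no constant term and so makes sense in \<open>C0_01\<close>, and the functions t p(t)
  are dense because f(0) = 0. Existence: at first h is known only as a self-adjoint contraction, so
  its calculus lives on [-1,1] and sends \<open>id_01\<close> to the positive part of h; this is h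
  only once the negative part vanishes. Unitaries and constant polynomials need a unit, which C need
  not have; the estimates are therefore made in a type of unital algebras into which the multipliers
  of C embed.\<close>

lemma scaleC_zero_left [simp]: "0 *\<^sub>C (x::'a::cstar_algebra) = 0"
  using scaleC_of_real[of 0 x] by simp

lemma scaleC_one [simp]: "1 *\<^sub>C (x::'a::cstar_algebra) = x"
  using scaleC_of_real[of 1 x] by simp

lemma scaleC_zero_right [simp]: "c *\<^sub>C (0::'a::cstar_algebra) = 0"
  using scaleC_add_right[of c 0 "0::'a"] by simp

lemma scaleC_minus_right: "c *\<^sub>C (- x) = - (c *\<^sub>C (x::'a::cstar_algebra))"
  using scaleC_add_right[of c x "- x"] by (simp add: eq_neg_iff_add_eq_0 add.commute)

lemma scaleC_diff_right: "c *\<^sub>C (x - y) = c *\<^sub>C x - c *\<^sub>C (y::'a::cstar_algebra)"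
  using scaleC_add_right[of c x "- y"] by (simp add: scaleC_minus_right)

lemma scaleC_minus_left: "(- c) *\<^sub>C x = - (c *\<^sub>C (x::'a::cstar_algebra))"
  using scaleC_add_left[of c "- c" x] by (simp add: eq_neg_iff_add_eq_0 add.commute)

lemma scaleC_minus_one [simp]: "(- 1) *\<^sub>C x = - (x::'a::cstar_algebra)"
  by (simp add: scaleC_minus_left)

lemma adj_zero [simp]: "adj (0::'a::cstar_algebra) = 0"
  using adj_add[of 0 "0::'a"] by simp

lemma adj_minus: "adj (- x) = - adj (x::'a::cstar_algebra)"
  using adj_add[of x "- x"] by (simp add: eq_neg_iff_add_eq_0 add.commute)

lemma adj_diff: "adj (x - y) = adj x - adj (y::'a::cstar_algebra)"
  using adj_add[of x "- y"] by (simp add: adj_minus)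

lemma adj_scaleR: "adj (r *\<^sub>R x) = r *\<^sub>R adj (x::'a::cstar_algebra)"
  by (metis adj_scaleC scaleC_of_real complex_cnj_complex_of_real)

lemma norm_adj [simp]: "norm (adj x) = norm (x::'a::cstar_algebra)"
proof -
  have le: "norm y \<le> norm (adj y)" for y :: 'a
  proof (cases "y = 0")
    case False
    have "(norm y)\<^sup>2 \<le> norm (adj y) * norm y"
      by (metis cstar_identity norm_mult_ineq)
    then show ?thesis
      using False by (simp add: power2_eq_square)
  qed auto
  show ?thesis
    using le[of x] le[of "adj x"] by (simp add: adj_adj)
qed

lemma cstar_identity': "norm (x * adj x) = (norm (x::'a::cstar_algebra))\<^sup>2"
  using cstar_identity[of "adj x"] by (simp add: adj_adj)

lemma adj_mult_self_eq_0: "adj x * x = 0 \<longleftrightarrow> x = (0::'a::cstar_algebra)"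
  using cstar_identity[of x] by auto

lemma bounded_linear_adj: "bounded_linear (adj :: 'a::cstar_algebra \<Rightarrow> 'a)"
  by (rule bounded_linear_intro[of _ 1]) (auto simp: adj_add adj_scaleR)

lemma tendsto_adj: "(f \<longlongrightarrow> l) F \<Longrightarrow> ((\<lambda>x. adj (f x :: 'a::cstar_algebra)) \<longlongrightarrow> adj l) F"
  by (rule bounded_linear.tendsto[OF bounded_linear_adj])

lemma bounded_linear_scaleC: "bounded_linear (\<lambda>x::'a::cstar_algebra. c *\<^sub>C x)"
proof (rule bounded_linear_intro[of _ "cmod c"])
  show "c *\<^sub>C (r *\<^sub>R x) = r *\<^sub>R (c *\<^sub>C x)" for r and x :: 'a
    by (simp add: scaleC_of_real[symmetric] scaleC_scaleC mult.commute)
qed (auto simp: scaleC_add_right norm_scaleC mult.commute)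

lemma tendsto_scaleC:
  "(f \<longlongrightarrow> l) F \<Longrightarrow> ((\<lambda>x. c *\<^sub>C (f x :: 'a::cstar_algebra)) \<longlongrightarrow> c *\<^sub>C l) F"
  by (rule bounded_linear.tendsto[OF bounded_linear_scaleC])

text \<open>\<open>0 = 1\<close> is permitted: over a zero algebra \<open>'b\<close> the families of
  multipliers built below form a zero algebra. Hence \<open>norm 1\<close> is only bounded by
  1.\<close>

class unital_cstar_algebra = cstar_algebra + monoid_mult

lemma adj_one [simp]: "adj 1 = (1::'a::unital_cstar_algebra)"
  by (metis adj_adj adj_mult mult_1_left mult_1_right)

lemma norm_one_le [simp]: "norm (1::'a::unital_cstar_algebra) \<le> 1"
  using cstar_identity[of "1::'a"] by (cases "norm (1::'a) = 0") (auto simp: power2_eq_square)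

lemma norm_power_le: "norm ((x::'a::unital_cstar_algebra) ^ n) \<le> norm x ^ n"
proof (induction n)
  case (Suc n)
  then show ?case
    using norm_mult_ineq[of x "x ^ n"] by (smt (verit) mult_left_mono norm_ge_zero power_Suc)
qed simp

lemma adj_power: "adj ((x::'a::unital_cstar_algebra) ^ n) = adj x ^ n"
  by (induction n) (simp_all add: adj_mult power_commutes)

text \<open>The C*-identity makes squaring a self-adjoint element exact for the norm. Exponents
  \<open>2 ^ n\<close> are thus the ones along which a growth estimate gives back the norm
  itself.\<close>

lemma norm_power_two_power:
  fixes x :: "'a::unital_cstar_algebra"
  assumes "adj x = x"
  shows "norm (x ^ (2 ^ n)) = norm x ^ (2 ^ n)"
proof (induction n)
  case (Suc n)
  have "norm (x ^ (2 ^ Suc n)) = norm (adj (x ^ (2 ^ n)) * x ^ (2 ^ n))"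
    using assms by (simp add: adj_power power_add[symmetric] mult_2)
  also have "\<dots> = norm x ^ (2 ^ Suc n)"
    by (simp only: cstar_identity Suc.IH) (simp add: power_mult[symmetric] mult.commute)
  finally show ?case .
qed simp

section \<open>Square roots and contractivity of \<open>*\<close>-homomorphisms\<close>

text \<open>The equation says that \<open>(1 + b)\<^sup>2 = 1 - a\<^sup>2\<close>; in this form it makes sense, and is solved by
  the contraction principle, in a non-unital algebra.\<close>

lemma quasi_sqrt_exists:
  fixes a :: "'a::cstar_algebra"
  assumes "adj a = a" and "norm a < 1"
  shows "\<exists>b. adj b = b \<and> a * b = b * a \<and> a * a + b * b + 2 *\<^sub>R b = 0"
proof -
  \<comment> \<open>The smaller root of r^2 - 2 r + (norm a)^2 = 0: F maps the ball of this radius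
    into itself and is a contraction there with the same constant.\<close>
  define \<rho> where "\<rho> = 1 - sqrt (1 - (norm a)\<^sup>2)"
  have na: "(norm a)\<^sup>2 < 1"
    using assms(2) by (simp add: power_less_one_iff abs_square_less_1)
  then have \<rho>: "0 \<le> \<rho>" "\<rho> < 1"
    by (auto simp: \<rho>_def)
  have "(1 - \<rho>)\<^sup>2 = 1 - (norm a)\<^sup>2"
    using na by (simp add: \<rho>_def)
  then have \<rho>2: "(norm a)\<^sup>2 + \<rho>\<^sup>2 = 2 * \<rho>"
    by (simp add: power2_eq_square algebra_simps)
  \<comment> \<open>Self-adjointness and commutation with a are closed conditions preserved by F, so
    the fixed point inherits them.\<close>
  define S where "S = {b. norm b \<le> \<rho>} \<inter> {b. adj b = b} \<inter> {b. a * b = b * a}"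
  define F where "F b = (- 1 / 2) *\<^sub>R (a * a + b * b)" for b
  have cadj: "continuous_on UNIV (adj :: 'a \<Rightarrow> 'a)"
    by (rule linear_continuous_on[OF bounded_linear_adj])
  have "closed S"
    unfolding S_def by (intro closed_Int closed_Collect_le closed_Collect_eq cadj continuous_intros)
  then have "complete S"
    by (simp add: complete_eq_closed)
  moreover have "0 \<in> S"
    using \<rho> by (simp add: S_def)
  moreover have "F ` S \<subseteq> S"
  proof (clarify)
    fix b assume b: "b \<in> S"
    have "norm (a * a + b * b) \<le> norm a * norm a + norm b * norm b"
      by (meson add_mono norm_mult_ineq norm_triangle_le)
    also have "\<dots> \<le> (norm a)\<^sup>2 + \<rho>\<^sup>2"
      using b \<rho> by (auto simp: S_def power2_eq_square intro!: mult_mono)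
    finally have "norm (F b) \<le> \<rho>"
      using \<rho>2 by (simp add: F_def)
    moreover have "adj b = b" "a * b = b * a"
      using b by (auto simp: S_def)
    then have adjF: "adj (F b) = F b"
      unfolding F_def adj_scaleR adj_add adj_mult assms(1) by simp
    have "a * (b * b) = b * b * a"
      by (metis \<open>a * b = b * a\<close> mult.assoc)
    then have "a * F b = F b * a"
      by (simp add: F_def distrib_left distrib_right mult.assoc del: scaleR_minus_left)
    ultimately show "F b \<in> S"
      using adjF unfolding S_def by blast
  qed
  moreover have "dist (F x) (F y) \<le> \<rho> * dist x y" if "x \<in> S" "y \<in> S" for x y
  proof -
    have "x * x - y * y = x * (x - y) + (x - y) * y"
      by (simp add: algebra_simps)
    then have "norm (x * x - y * y) \<le> norm x * norm (x - y) + norm (x - y) * norm y"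
      by (metis add_mono norm_mult_ineq norm_triangle_le)
    also have "\<dots> \<le> \<rho> * norm (x - y) + norm (x - y) * \<rho>"
      using that by (intro add_mono mult_mono) (auto simp: S_def \<rho>)
    finally have "norm (x * x - y * y) \<le> 2 * (\<rho> * norm (x - y))"
      by simp
    moreover have "F x - F y = (- 1 / 2) *\<^sub>R (x * x - y * y)"
      by (simp add: F_def algebra_simps)
    ultimately show ?thesis
      by (simp add: dist_norm)
  qed
  ultimately obtain b where "b \<in> S" "F b = b"
    using Banach_fix[of S \<rho> F] \<rho> by blast
  moreover have "- (a * a + b * b) = 2 *\<^sub>R F b"
    by (simp add: F_def)
  ultimately have "a * a + b * b + 2 *\<^sub>R b = 0"
    by (simp only: neg_eq_iff_add_eq_0)
  then show ?thesis
    using \<open>b \<in> S\<close> unfolding S_def by blast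
qed

section \<open>Unitaries with prescribed real part\<close>

definition unitary_of :: "'a::unital_cstar_algebra \<Rightarrow> 'a \<Rightarrow> 'a" where
  "unitary_of a b = a + \<i> *\<^sub>C (1 + b)"

lemma unitary_of:
  fixes a b :: "'a::unital_cstar_algebra"
  assumes "adj a = a" "adj b = b" "a * b = b * a" "a * a + b * b + 2 *\<^sub>R b = 0"
  shows "adj (unitary_of a b) * unitary_of a b = 1"
    and "unitary_of a b * adj (unitary_of a b) = 1"
    and "unitary_of a b + adj (unitary_of a b) = 2 *\<^sub>R a"
proof -
  have adj: "adj (unitary_of a b) = a - \<i> *\<^sub>C (1 + b)"
    using assms by (simp add: unitary_of_def adj_add adj_scaleC scaleC_minus_left)
  define c where "c = 1 + b"
  have eq: "a * a + c * c = 1" and ac: "a * c = c * a"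
    using assms(3,4) by (simp_all add: c_def algebra_simps scaleR_2)
  show "adj (unitary_of a b) * unitary_of a b = 1" "unitary_of a b * adj (unitary_of a b) = 1"
    unfolding adj unfolding unitary_of_def c_def[symmetric] using eq ac
    by (simp_all add: algebra_simps scaleC_diff_right scaleC_add_right scaleC_mult_left
        scaleC_mult_right scaleC_scaleC)
  show "unitary_of a b + adj (unitary_of a b) = 2 *\<^sub>R a"
    unfolding adj by (simp add: unitary_of_def scaleR_2)
qed

lemma norm_isometry_le:
  fixes u :: "'a::unital_cstar_algebra"
  assumes "adj u * u = 1"
  shows "norm u \<le> 1"
  using cstar_identity[of u] assms norm_one_le[where ?'a='a] 
  by (simp add: abs_square_le_1)

text \<open>\<open>a\<close> is the real part of the unitary \<open>a + i(1 + b)\<close>.\<close>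

lemma norm_le_one_if_quasi_sqrt:
  fixes a b :: "'a::unital_cstar_algebra"
  assumes "adj a = a" "adj b = b" "a * b = b * a" "a * a + b * b + 2 *\<^sub>R b = 0"
  shows "norm a \<le> 1"
proof -
  have "norm (unitary_of a b) \<le> 1"
    by (rule norm_isometry_le[OF unitary_of(1)[OF assms]])
  then have "norm (2 *\<^sub>R a) \<le> 2"
    unfolding unitary_of(3)[OF assms, symmetric]
    by (intro norm_triangle_le) simp
  then show ?thesis
    by simp
qed

text \<open>\<open>1 + b\<close> is the imaginary part of the same unitary.\<close>

lemma norm_le_one_plus_quasi_sqrt:
  fixes a b :: "'a::unital_cstar_algebra"
  assumes "adj a = a" "adj b = b" "a * b = b * a" "a * a + b * b + 2 *\<^sub>R b = 0"
  shows "norm (1 + b) \<le> 1"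
proof -
  let ?u = "unitary_of a b"
  have "norm ?u \<le> 1"
    by (rule norm_isometry_le[OF unitary_of(1)[OF assms]])
  moreover have "?u - adj ?u = 2 *\<^sub>R (\<i> *\<^sub>C (1 + b))"
    using assms by (simp add: unitary_of_def adj_add adj_scaleC scaleC_minus_left scaleR_2)
  ultimately have "norm (2 *\<^sub>R (\<i> *\<^sub>C (1 + b))) \<le> 2"
    by (metis norm_adj norm_triangle_le_diff one_add_one add_mono)
  then show ?thesis
    by (simp add: norm_scaleC)
qed

text \<open>The relations of \<open>quasi_sqrt_exists\<close> do not mention a unit, so \<rho>
  carries them from a possibly non-unital domain into the unital codomain, where they force norm at
  most 1. Scaling gives all self-adjoint elements, and the C*-identity for \<open>adj a * a\<close>
  the rest.\<close>

lemma star_hom_contractive: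
  fixes \<rho> :: "'a::cstar_algebra \<Rightarrow> 'm::unital_cstar_algebra"
  assumes add: "\<And>a b. \<rho> (a + b) = \<rho> a + \<rho> b"
    and scale: "\<And>c a. \<rho> (c *\<^sub>C a) = c *\<^sub>C \<rho> a"
    and mult: "\<And>a b. \<rho> (a * b) = \<rho> a * \<rho> b"
    and adj: "\<And>a. \<rho> (adj a) = adj (\<rho> a)"
  shows "norm (\<rho> a) \<le> norm a"
proof -
  have scaleR: "\<rho> (r *\<^sub>R x) = r *\<^sub>R \<rho> x" for r x
    using scale[of "complex_of_real r" x] by (simp add: scaleC_of_real)
  have zero: "\<rho> 0 = 0"
    using scale[of 0 0] by simp
  have *: "norm (\<rho> x) \<le> 1" if x: "adj x = x" "norm x < 1" for x
  proof -
    obtain y where "adj y = y" "x * y = y * x" "x * x + y * y + 2 *\<^sub>R y = 0"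
      using quasi_sqrt_exists[OF x] by blast
    then show ?thesis
      using x by (intro norm_le_one_if_quasi_sqrt[of _ "\<rho> y"])
        (auto simp: adj[symmetric] mult[symmetric] add[symmetric] scaleR[symmetric] zero)
  qed
  have sa: "norm (\<rho> x) \<le> norm x" if x: "adj x = x" for x
  proof (rule dense_ge)
    fix t assume t: "norm x < t"
    then have "0 < t"
      using norm_ge_zero[of x] by linarith
    then have "norm (\<rho> ((1 / t) *\<^sub>R x)) \<le> 1"
      using t x by (intro *) (auto simp: adj_scaleR)
    then show "norm (\<rho> x) \<le> t"
      using \<open>0 < t\<close> by (simp add: scaleR field_simps)
  qed
  have "(norm (\<rho> a))\<^sup>2 = norm (\<rho> (adj a * a))"
    by (simp add: mult adj cstar_identity)
  also have "\<dots> \<le> norm (adj a * a)"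
    by (rule sa) (simp add: adj_mult adj_adj)
  finally show ?thesis
    by (simp add: cstar_identity power_mono_iff)
qed

section \<open>Polynomials in a self-adjoint contraction\<close>

text \<open>Horner evaluation with complex coefficients at a point of a non-commutative algebra, the
  scalars acting by \<open>scaleC\<close>.\<close>

definition poly_at :: "complex poly \<Rightarrow> 'a::unital_cstar_algebra \<Rightarrow> 'a" where
  "poly_at p x = fold_coeffs (\<lambda>c y. c *\<^sub>C 1 + x * y) p 0"

lemma poly_at_0 [simp]: "poly_at 0 x = 0"
  by (simp add: poly_at_def)

lemma poly_at_pCons [simp]: "poly_at (pCons c p) x = c *\<^sub>C 1 + x * poly_at p x"
  by (cases "p = 0 \<and> c = 0") (auto simp: poly_at_def)

lemma poly_at_add: "poly_at (p + q) x = poly_at p x + poly_at q x"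
  by (induction p q rule: poly_induct2) (simp_all add: algebra_simps scaleC_add_left)

lemma poly_at_smult: "poly_at (smult c p) x = c *\<^sub>C poly_at p x"
  by (induction p) (simp_all add: scaleC_add_right scaleC_scaleC scaleC_mult_right)

lemma poly_at_mult: "poly_at (p * q) x = poly_at p x * poly_at q x"
  by (induction p)
    (simp_all add: poly_at_add poly_at_smult scaleC_mult_left mult.assoc distrib_right)

lemma poly_at_monom: "poly_at (monom c n) x = c *\<^sub>C x ^ n"
  by (induction n) (simp_all add: monom_0 monom_Suc scaleC_mult_right)

lemma poly_at_power: "poly_at (p ^ n) x = poly_at p x ^ n"
  by (induction n) (simp_all add: poly_at_mult one_pCons)

lemma poly_at_commute: "z * x = x * z \<Longrightarrow> z * poly_at p x = poly_at p x * z"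
  by (induction p)
    (simp_all add: scaleC_mult_left scaleC_mult_right distrib_left distrib_right,
      metis mult.assoc)

lemma adj_poly_at:
  assumes "adj x = x"
  shows "adj (poly_at p x) = poly_at (map_poly cnj p) x"
  by (induction p)
    (simp_all add: map_poly_pCons adj_add adj_scaleC adj_mult assms poly_at_commute)

lemma tendsto_poly_at:
  assumes "(g \<longlongrightarrow> x) F"
  shows "((\<lambda>n. poly_at p (g n)) \<longlongrightarrow> poly_at p x) F"
  by (induction p) (auto intro!: tendsto_intros assms)

text \<open>Cauchy's estimate on the unit circle for the n-th derivative at 0, which is n! times the
  coefficient.\<close>

lemma norm_coeff_le_sup_circle:
  assumes "\<And>z. cmod z = 1 \<Longrightarrow> cmod (poly p z) \<le> B"
  shows "cmod (coeff p n) \<le> B"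
proof -
  have "deriv (poly q) = poly (pderiv q)" for q :: "complex poly"
    by (intro ext DERIV_imp_deriv poly_DERIV)
  then have "(deriv ^^ n) (poly p) = poly ((pderiv ^^ n) p)"
    by (induction n) auto
  moreover have "poly ((pderiv ^^ n) p) 0 = fact n * coeff p n"
    by (simp add: poly_0_coeff_0 coeff_higher_pderiv pochhammer_fact)
  moreover have "cmod ((deriv ^^ n) (poly p) 0) \<le> fact n * B / 1 ^ n"
    by (rule Cauchy_inequality) (auto intro!: holomorphic_intros continuous_intros assms)
  ultimately show ?thesis
    by (simp add: norm_mult)
qed

lemma norm_poly_at_le_degree:
  fixes u :: "'a::unital_cstar_algebra"
  assumes "norm u \<le> 1" "\<And>n. cmod (coeff p n) \<le> B" "degree p \<le> N"
  shows "norm (poly_at p u) \<le> (real N + 1) * B"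
  using assms(2,3)
proof (induction p arbitrary: N)
  case 0
  then show ?case
    using norm_ge_zero[of "0::complex"] by (auto intro!: mult_nonneg_nonneg)
next
  case (pCons c p)
  have "norm (c *\<^sub>C (1::'a)) \<le> cmod c * 1"
    unfolding norm_scaleC by (intro mult_left_mono) auto
  also have "\<dots> \<le> B"
    using pCons.prems(1)[of 0] by simp
  finally have c: "norm (c *\<^sub>C (1::'a)) \<le> B" .
  have "0 \<le> B"
    using c norm_ge_zero order_trans by blast
  show ?case
  proof (cases "p = 0")
    case True
    then show ?thesis
      using c \<open>0 \<le> B\<close> by (simp add: distrib_right)
        (meson add_increasing mult_nonneg_nonneg of_nat_0_le_iff)
  next
    case False
    then obtain N' where N': "N = Suc N'" "degree p \<le> N'"
      using pCons.prems(2) by (cases N) auto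
    have "norm (u * poly_at p u) \<le> 1 * norm (poly_at p u)"
      by (rule order_trans[OF norm_mult_ineq]) (intro mult_right_mono assms(1) norm_ge_zero)
    also have "\<dots> \<le> (real N' + 1) * B"
      using pCons.IH[OF _ N'(2)] pCons.prems(1) by (metis coeff_pCons_Suc mult_1)
    finally show ?thesis
      using c N'(1) norm_triangle_ineq[of "c *\<^sub>C 1" "u * poly_at p u"]
      by (simp add: algebra_simps)
  qed
qed

text \<open>The factor of degree d clears the negative powers. One polynomial p serves both for
  numbers z and for elements u, since only z (1/z) = 1 and \<open>u * adj u = 1\<close> are used;
  this lets a bound on the circle control the coefficients of what is evaluated at u.\<close>

lemma laurent_polynomial_at_unitary:
  assumes "degree q \<le> d"
  shows "\<exists>p. degree p \<le> 2 * d \<and>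
    (\<forall>z. z \<noteq> 0 \<longrightarrow> poly p z = z ^ d * poly q ((z + 1 / z) / 2)) \<and>
    (\<forall>u::'a::unital_cstar_algebra. u * adj u = 1 \<longrightarrow>
      poly_at p u = u ^ d * poly_at q ((1 / 2) *\<^sub>R (u + adj u)))"
  using assms
proof (induction q arbitrary: d)
  case 0
  show ?case
    by (rule exI[of _ 0]) auto
next
  case (pCons c q)
  show ?case
  proof (cases d)
    case 0
    then have "q = 0"
      using pCons.prems by (auto split: if_splits)
    then show ?thesis
      using 0 by (intro exI[of _ "[:c:]"]) auto
  next
    case (Suc d')
    then have "degree q \<le> d'"
      using pCons.prems by (auto split: if_splits)
    from pCons.IH[OF this] obtain p where p: "degree p \<le> 2 * d'"
      "\<And>z. z \<noteq> 0 \<Longrightarrow> poly p z = z ^ d' * poly q ((z + 1 / z) / 2)"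
      "\<And>u::'a. u * adj u = 1 \<Longrightarrow> poly_at p u = u ^ d' * poly_at q ((1 / 2) *\<^sub>R (u + adj u))"
      by blast
    \<comment> \<open>With w = (z + 1/z) / 2 the first factor is z w = (1 + z^2) / 2, which raises
      z^d' q(w) to z^d w q(w); the monomial is z^d times the constant term c.\<close>
    define r where "r = [:1 / 2, 0, 1 / 2:] * p + monom c d"
    have "degree ([:1 / 2, 0, 1 / 2:] * p) \<le> 2 + 2 * d'"
      using degree_mult_le[of "[:1 / 2, 0, 1 / 2:]" p] p(1) by simp
    moreover have "degree (monom c d) \<le> 2 * d"
      using degree_monom_le[of c d] by simp
    ultimately have "degree r \<le> 2 * d"
      unfolding r_def using Suc by (intro degree_add_le) auto
    moreover have "poly r z = z ^ d * poly (pCons c q) ((z + 1 / z) / 2)" if "z \<noteq> 0" for z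
      using that by (simp add: r_def poly_monom p(2) Suc field_simps)
    moreover have "poly_at r u = u ^ d * poly_at (pCons c q) ((1 / 2) *\<^sub>R (u + adj u))"
      if u: "u * adj u = 1" for u :: 'a
    proof -
      define a where "a = (1 / 2) *\<^sub>R (u + adj u)"
      define x where "x = poly_at [:1 / 2, 0, 1 / 2:] u"
      have x: "x = u * a"
        using u scaleC_of_real[of "1 / 2" "1::'a"] scaleC_of_real[of "1 / 2" "u * u"]
        by (simp add: x_def a_def scaleC_mult_right distrib_left scaleR_add_right add.commute)
      have "u ^ d' * x = x * u ^ d'"
        unfolding x_def by (rule poly_at_commute) (rule power_commutes)
      then have "x * (u ^ d' * poly_at q a) = u ^ d' * (u * a) * poly_at q a"
        by (simp only: mult.assoc[symmetric] x[symmetric])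
      also have "\<dots> = u ^ d * (a * poly_at q a)"
        by (simp only: Suc power_Suc2 mult.assoc)
      finally have "x * poly_at p u = u ^ d * (a * poly_at q a)"
        using p(3)[OF u] by (simp add: a_def)
      moreover have "poly_at r u = x * poly_at p u + c *\<^sub>C u ^ d"
        by (simp only: r_def poly_at_add poly_at_mult poly_at_monom x_def)
      ultimately show ?thesis
        by (simp add: a_def distrib_left scaleC_mult_right add.commute)
    qed
    ultimately show ?thesis
      by blast
  qed
qed

text \<open>On the unit circle (z + 1/z) / 2 is the real part of z, so B bounds p there and hence
  each of its 2 d + 1 coefficients. Multiplication by \<open>adj u ^ d\<close> recovers q(a) from
  p(u).\<close>

lemma norm_poly_at_le_crude:
  fixes a :: "'a::unital_cstar_algebra"
  assumes "adj a = a" "norm a < 1" "degree q \<le> d"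
    and B: "\<And>t. t \<in> {-1..1} \<Longrightarrow> cmod (poly q (of_real t)) \<le> B"
  shows "norm (poly_at q a) \<le> (2 * real d + 1) * B"
proof -
  obtain b where b: "adj b = b" "a * b = b * a" "a * a + b * b + 2 *\<^sub>R b = 0"
    using quasi_sqrt_exists[OF assms(1,2)] by blast
  define u where "u = unitary_of a b"
  note u = unitary_of[OF assms(1) b, folded u_def]
  have nu: "norm u \<le> 1"
    using u(1) by (rule norm_isometry_le)
  obtain p where p: "degree p \<le> 2 * d"
    "\<And>z. z \<noteq> 0 \<Longrightarrow> poly p z = z ^ d * poly q ((z + 1 / z) / 2)"
    "\<And>u::'a. u * adj u = 1 \<Longrightarrow> poly_at p u = u ^ d * poly_at q ((1 / 2) *\<^sub>R (u + adj u))"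
    using laurent_polynomial_at_unitary[OF assms(3), where ?'a='a] by blast
  have "cmod (poly p z) \<le> B" if z: "cmod z = 1" for z
  proof -
    have "1 / z = cnj z"
      using z complex_norm_square[of z] inverse_unique[of z "cnj z"]
      by (simp add: inverse_eq_divide)
    then have "(z + 1 / z) / 2 = of_real (Re z)"
      by (simp add: complex_eq_iff)
    moreover have "Re z \<in> {-1..1}"
      using abs_Re_le_cmod[of z] z by auto
    moreover have "z \<noteq> 0"
      using z by auto
    ultimately show ?thesis
      using B z by (simp add: p(2) norm_mult norm_power)
  qed
  then have "norm (poly_at p u) \<le> (real (2 * d) + 1) * B"
    by (intro norm_poly_at_le_degree nu norm_coeff_le_sup_circle p(1)) auto
  moreover have "adj u ^ n * u ^ n = 1" for n
  proof (induction n)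
    case (Suc n)
    have "adj u ^ Suc n * u ^ Suc n = adj u ^ n * (adj u * u) * u ^ n"
      using power_Suc2[of "adj u" n] by (simp only: power_Suc[of u] mult.assoc)
    then show ?case
      using Suc u(1) by simp
  qed simp
  then have "poly_at q a = adj u ^ d * poly_at p u"
    using u(3) by (simp add: p(3)[OF u(2)] mult.assoc[symmetric])
  moreover have "norm (adj u ^ d) \<le> 1"
    by (rule order_trans[OF norm_power_le]) (simp add: nu power_le_one)
  ultimately show ?thesis
    using norm_mult_ineq[of "adj u ^ d" "poly_at p u"]
      mult_right_mono[of "norm (adj u ^ d)" 1 "norm (poly_at p u)"] by simp
qed

text \<open>The crude bound grows linearly in the degree, so applying it to high powers removes the
  constant.\<close>

lemma norm_poly_at_le_strict:
  fixes a :: "'a::unital_cstar_algebra"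
  assumes "adj a = a" "norm a < 1" "0 < B"
    and B: "\<And>t. t \<in> {-1..1} \<Longrightarrow> cmod (poly q (of_real t)) \<le> B"
  shows "norm (poly_at q a) \<le> B"
proof -
  \<comment> \<open>On the reals r is |q|^2, and r(a) is self-adjoint, so that
    \<open>norm_power_two_power\<close> applies to it.\<close>
  define r where "r = map_poly cnj q * q"
  define y where "y = poly_at r a"
  define c where "c = norm y / B\<^sup>2"
  define D where "D = real (degree r)"
  have y: "y = adj (poly_at q a) * poly_at q a"
    by (simp add: y_def r_def poly_at_mult adj_poly_at assms(1))
  then have ny: "norm y = (norm (poly_at q a))\<^sup>2" and "adj y = y"
    by (simp_all add: cstar_identity adj_mult adj_adj)
  have "poly (map_poly cnj q) (of_real t) = cnj (poly q (of_real t))" for t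
    by (induction q) (auto simp: map_poly_pCons)
  then have r: "cmod (poly r (of_real t)) \<le> B\<^sup>2" if "t \<in> {-1..1}" for t
    using B[OF that] by (simp add: r_def norm_mult power2_eq_square mult_mono assms(3) less_imp_le)
  have "c ^ (2 ^ n) \<le> 2 * D * 2 ^ n + 1" for n
  proof -
    have "norm (poly_at (r ^ (2 ^ n)) a) \<le> (2 * real (degree r * 2 ^ n) + 1) * (B\<^sup>2) ^ (2 ^ n)"
      using r by (intro norm_poly_at_le_crude assms)
        (auto simp: degree_power_le norm_power poly_power intro!: power_mono)
    then have "norm y ^ (2 ^ n) \<le> (2 * D * 2 ^ n + 1) * (B\<^sup>2) ^ (2 ^ n)"
      using norm_power_two_power[OF \<open>adj y = y\<close>, of n] by (simp add: poly_at_power y_def D_def mult.assoc)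
    then show ?thesis
      using \<open>0 < B\<close> by (simp add: c_def power_divide divide_le_eq)
  qed
  moreover have "c \<le> 1"
  proof (rule ccontr)
    assume "\<not> c \<le> 1"
    then have "1 < c" by simp
    \<comment> \<open>In terms of the exponent N = 2^n the bound reads c^N <= 2 D N + 1, which
      exponential growth contradicts.\<close>
    have "(\<lambda>n. of_nat n * inverse c ^ n) \<longlonglongrightarrow> 0"
      by (rule powser_times_n_limit_0) (use \<open>1 < c\<close> in \<open>auto simp: inverse_less_1_iff\<close>)
    then have "(\<lambda>n. (2 * D) * (of_nat n * inverse c ^ n) + inverse c ^ n) \<longlonglongrightarrow> (2 * D) * 0 + 0"
      using \<open>1 < c\<close> by (intro tendsto_intros LIMSEQ_realpow_zero) (auto simp: inverse_less_1_iff)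
    then have "(\<lambda>n. (2 * D * of_nat n + 1) * inverse c ^ n) \<longlonglongrightarrow> 0"
      by (simp add: algebra_simps)
    from LIMSEQ_subseq_LIMSEQ[OF this, of "\<lambda>n. 2 ^ n"]
    have "(\<lambda>n. (2 * D * 2 ^ n + 1) * inverse c ^ (2 ^ n)) \<longlonglongrightarrow> 0"
      by (simp add: strict_mono_def o_def)
    then have "1 \<le> (0::real)"
      by (rule LIMSEQ_le_const)
        (use calculation \<open>1 < c\<close> in \<open>auto simp: power_inverse divide_inverse[symmetric] le_divide_eq\<close>)
    then show False by simp
  qed
  then have "(norm (poly_at q a))\<^sup>2 \<le> B\<^sup>2"
    using \<open>0 < B\<close> by (simp add: c_def ny)
  then show ?thesis
    using \<open>0 < B\<close> by (simp add: power_mono_iff)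
qed

text \<open>The strict hypotheses are removed by limits: B is approached by larger, hence positive,
  bounds e, and a by multiples of itself in the open unit ball.\<close>

lemma norm_poly_at_le:
  fixes a :: "'a::unital_cstar_algebra"
  assumes "adj a = a" "norm a \<le> 1"
    and B: "\<And>t. t \<in> {-1..1} \<Longrightarrow> cmod (poly q (of_real t)) \<le> B"
  shows "norm (poly_at q a) \<le> B"
proof (rule dense_ge)
  fix e assume "B < e"
  have "0 \<le> B"
    using order_trans[OF norm_ge_zero B[of 0]] by simp
  define g where "g n = (1 - inverse (real (Suc n))) *\<^sub>R a" for n
  have g: "norm (g n) < 1" for n
  proof -
    have "norm (g n) \<le> (1 - inverse (real (Suc n))) * 1"
      unfolding g_def norm_scaleR using assms(2) by (intro mult_mono) (auto simp: field_simps)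
    then show ?thesis
      by (rule le_less_trans) simp
  qed
  have "norm (poly_at q (g n)) \<le> e" for n
  proof (rule norm_poly_at_le_strict)
    show "cmod (poly q (of_real t)) \<le> e" if "t \<in> {-1..1}" for t
      using B[OF that] \<open>B < e\<close> by simp
    show "adj (g n) = g n"
      by (simp only: g_def adj_scaleR assms(1))
  qed (use \<open>B < e\<close> \<open>0 \<le> B\<close> g in auto)
  moreover have "g \<longlonglongrightarrow> (1 - 0) *\<^sub>R a"
    unfolding g_def by (intro tendsto_intros LIMSEQ_inverse_real_of_nat)
  then have "(\<lambda>n. norm (poly_at q (g n))) \<longlonglongrightarrow> norm (poly_at q a)"
    by (intro tendsto_norm tendsto_poly_at) simp
  ultimately show "norm (poly_at q a) \<le> e"
    by (intro LIMSEQ_le_const2) auto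
qed

section \<open>Continuous functional calculus of a self-adjoint contraction\<close>

definition poly_approx :: "(nat \<Rightarrow> complex poly) \<Rightarrow> (real \<Rightarrow> complex) \<Rightarrow> bool" where
  "poly_approx p f \<longleftrightarrow>
     uniform_limit {-1..1} (\<lambda>n t. poly (p n) (complex_of_real t)) f sequentially"

lemma real_polynomial_function_as_poly:
  assumes "real_polynomial_function r"
  shows "\<exists>p. \<forall>t. poly p (complex_of_real t) = complex_of_real (r t)"
proof -
  obtain a n where "r = (\<lambda>x. \<Sum>i\<le>n. a i * x ^ i)"
    using assms unfolding real_polynomial_function_iff_sum by blast
  then show ?thesis
    by (intro exI[of _ "\<Sum>i\<le>n. monom (complex_of_real (a i)) i"]) (simp add: poly_sum poly_monom)
qed

text \<open>The Weierstrass approximants have real polynomials p and q as real and imaginary parts;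
  p + i q is a complex polynomial that agrees with the approximant on the real line.\<close>

lemma poly_approx_exists:
  assumes "continuous_on {-1..1} f"
  shows "\<exists>p. poly_approx p f"
proof -
  obtain g where g: "uniform_limit {-1..1} g f sequentially" "\<And>n. polynomial_function (g n)"
    using Stone_Weierstrass_uniform_limit[OF compact_Icc assms] by blast
  have "\<exists>p. \<forall>t. poly p (complex_of_real t) = g n t" for n
  proof -
    have rpf: "real_polynomial_function (L \<circ> g n)" if "bounded_linear L" for L :: "complex \<Rightarrow> real"
      using g(2) that unfolding polynomial_function_def by blast
    obtain p where p: "\<And>t. poly p (complex_of_real t) = complex_of_real (Re (g n t))"
      using real_polynomial_function_as_poly[OF rpf[OF bounded_linear_Re]] by auto
    obtain q where q: "\<And>t. poly q (complex_of_real t) = complex_of_real (Im (g n t))"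
      using real_polynomial_function_as_poly[OF rpf[OF bounded_linear_Im]] by auto
    show ?thesis
      by (intro exI[of _ "p + smult \<i> q"]) (simp add: p q complex_eq_iff)
  qed
  then obtain p where "\<And>n t. poly (p n) (complex_of_real t) = g n t"
    by metis
  then show ?thesis
    using g(1) by (intro exI[of _ p]) (simp add: poly_approx_def)
qed

lemma poly_approx_add:
  "poly_approx p f \<Longrightarrow> poly_approx q g \<Longrightarrow> poly_approx (\<lambda>n. p n + q n) (\<lambda>t. f t + g t)"
  unfolding poly_approx_def poly_add by (rule uniform_limit_add)

lemma poly_approx_diff:
  "poly_approx p f \<Longrightarrow> poly_approx q g \<Longrightarrow> poly_approx (\<lambda>n. p n - q n) (\<lambda>t. f t - g t)"
  unfolding poly_approx_def poly_diff by (rule uniform_limit_minus)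

lemma poly_approx_mult:
  assumes "poly_approx p f" "poly_approx q g"
    and "continuous_on {-1..1} f" "continuous_on {-1..1} g"
  shows "poly_approx (\<lambda>n. p n * q n) (\<lambda>t. f t * g t)"
  using assms unfolding poly_approx_def poly_mult
  by (intro uniform_lim_mult compact_imp_bounded compact_continuous_image compact_Icc)

lemma poly_approx_smult: "poly_approx p f \<Longrightarrow> poly_approx (\<lambda>n. smult c (p n)) (\<lambda>t. c * f t)"
  unfolding poly_approx_def poly_smult
  by (rule bounded_linear.uniform_limit[OF bounded_linear_mult_right])

lemma poly_approx_cnj: "poly_approx p f \<Longrightarrow> poly_approx (\<lambda>n. map_poly cnj (p n)) (\<lambda>t. cnj (f t))"
proof -
  assume "poly_approx p f"
  then have "uniform_limit {-1..1} (\<lambda>n t. cnj (poly (p n) (complex_of_real t))) (\<lambda>t. cnj (f t)) sequentially"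
    unfolding poly_approx_def by (rule bounded_linear.uniform_limit[OF bounded_linear_cnj])
  then show ?thesis
    by (simp only: poly_approx_def poly_cnj complex_cnj_complex_of_real)
qed

lemma poly_approx_cong:
  assumes "poly_approx p f" "\<And>t. t \<in> {-1..1} \<Longrightarrow> f t = g t"
  shows "poly_approx p g"
proof -
  have "uniform_limit {-1..1} (\<lambda>n t. poly (p n) (complex_of_real t)) f sequentially \<longleftrightarrow>
      uniform_limit {-1..1} (\<lambda>n t. poly (p n) (complex_of_real t)) g sequentially"
    by (rule uniform_limit_cong') (auto simp: assms(2))
  then show ?thesis
    using assms(1) by (simp add: poly_approx_def)
qed

lemma poly_approx_const: "poly_approx (\<lambda>n. p) (\<lambda>t. poly p (complex_of_real t))"
  unfolding poly_approx_def by (rule uniform_limit_const)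

lemma poly_at_diff: "poly_at (p - q) x = poly_at p x - poly_at q x"
  using poly_at_add[of "p - q" q x] by (simp add: algebra_simps)

text \<open>\<open>cfc_tendsto\<close> shows that the limit is the same for every approximating
  sequence.\<close>

definition cfc :: "'a::unital_cstar_algebra \<Rightarrow> (real \<Rightarrow> complex) \<Rightarrow> 'a" where
  "cfc x f = lim (\<lambda>n. poly_at ((SOME p. poly_approx p f) n) x)"

locale self_adjoint_contraction =
  fixes x :: "'a::unital_cstar_algebra"
  assumes adj_x: "adj x = x" and norm_x: "norm x \<le> 1"
begin

lemma eventually_norm_poly_at_le:
  assumes "poly_approx p f" "\<And>t. t \<in> {-1..1} \<Longrightarrow> cmod (f t) \<le> B" "B < e"
  shows "\<forall>\<^sub>F n in sequentially. norm (poly_at (p n) x) \<le> e"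
proof -
  have "\<forall>\<^sub>F n in sequentially. \<forall>t\<in>{-1..1}. dist (poly (p n) (complex_of_real t)) (f t) < e - B"
    using assms(1,3) unfolding poly_approx_def by (intro uniform_limitD) auto
  then show ?thesis
  proof eventually_elim
    case (elim n)
    show ?case
    proof (rule norm_poly_at_le[OF adj_x norm_x])
      fix t :: real assume "t \<in> {-1..1}"
      then show "cmod (poly (p n) (complex_of_real t)) \<le> e"
        using elim assms(2)[of t] norm_triangle_sub[of "poly (p n) (complex_of_real t)" "f t"]
        by (force simp: dist_norm)
    qed
  qed
qed

lemma poly_at_convergent:
  assumes "poly_approx p f"
  shows "convergent (\<lambda>n. poly_at (p n) x)"
proof -
  have "Cauchy (\<lambda>n. poly_at (p n) x)"
  proof (rule CauchyI)
    fix e :: real assume "0 < e"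
    then obtain N where N: "\<And>n t. n \<ge> N \<Longrightarrow> t \<in> {-1..1} \<Longrightarrow>
        cmod (poly (p n) (complex_of_real t) - f t) < e / 4"
      using assms unfolding poly_approx_def uniform_limit_sequentially_iff dist_norm
      by (metis zero_less_divide_iff zero_less_numeral)
    have "norm (poly_at (p m) x - poly_at (p n) x) < e" if "m \<ge> N" "n \<ge> N" for m n
    proof -
      have "norm (poly_at (p m - p n) x) \<le> e / 2"
      proof (rule norm_poly_at_le[OF adj_x norm_x])
        fix t :: real assume t: "t \<in> {-1..1}"
        show "cmod (poly (p m - p n) (complex_of_real t)) \<le> e / 2"
          using N[OF that(1) t] N[OF that(2) t]
            norm_triangle_ineq4[of "poly (p m) (complex_of_real t) - f t"
              "poly (p n) (complex_of_real t) - f t"] by simp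
      qed
      then show ?thesis
        using \<open>0 < e\<close> by (simp add: poly_at_diff)
    qed
    then show "\<exists>M. \<forall>m\<ge>M. \<forall>n\<ge>M. norm (poly_at (p m) x - poly_at (p n) x) < e"
      by blast
  qed
  then show ?thesis
    by (rule Cauchy_convergent)
qed

text \<open>The difference of two sequences approximating f approximates 0, so its values at x tend
  to 0.\<close>

lemma cfc_tendsto:
  assumes "poly_approx p f"
  shows "(\<lambda>n. poly_at (p n) x) \<longlonglongrightarrow> cfc x f"
proof -
  define q where "q = (SOME p. poly_approx p f)"
  have q: "poly_approx q f"
    unfolding q_def using assms by (rule someI[of "\<lambda>p. poly_approx p f"])
  have "(\<lambda>n. poly_at (q n) x) \<longlonglongrightarrow> cfc x f"
    using poly_at_convergent[OF q] by (simp add: convergent_LIMSEQ_iff cfc_def q_def)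
  moreover have "(\<lambda>n. poly_at (p n - q n) x) \<longlonglongrightarrow> 0"
  proof (rule tendstoI)
    fix e :: real assume "0 < e"
    then have "\<forall>\<^sub>F n in sequentially. norm (poly_at (p n - q n) x) \<le> e / 2"
      by (intro eventually_norm_poly_at_le[OF poly_approx_diff[OF assms q], of 0]) auto
    then show "\<forall>\<^sub>F n in sequentially. dist (poly_at (p n - q n) x) 0 < e"
      by eventually_elim (use \<open>0 < e\<close> in auto)
  qed
  ultimately have "(\<lambda>n. poly_at (q n) x + poly_at (p n - q n) x) \<longlonglongrightarrow> cfc x f + 0"
    by (rule tendsto_add)
  then show ?thesis
    by (simp add: poly_at_diff)
qed

lemma norm_cfc_le:
  assumes "continuous_on {-1..1} f" "\<And>t. t \<in> {-1..1} \<Longrightarrow> cmod (f t) \<le> B"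
  shows "norm (cfc x f) \<le> B"
proof (rule dense_ge)
  fix e assume "B < e"
  obtain p where p: "poly_approx p f"
    using poly_approx_exists[OF assms(1)] ..
  show "norm (cfc x f) \<le> e"
    by (rule tendsto_upperbound[OF tendsto_norm[OF cfc_tendsto[OF p]]])
      (auto intro: eventually_norm_poly_at_le[OF p assms(2) \<open>B < e\<close>])
qed

lemma cfc_poly: "cfc x (\<lambda>t. poly p (complex_of_real t)) = poly_at p x"
  using cfc_tendsto[OF poly_approx_const[of p]] by (simp add: LIMSEQ_const_iff)

lemma cfc_id: "cfc x complex_of_real = x"
  using cfc_poly[of "[:0, 1:]"] by simp

lemma cfc_one: "cfc x (\<lambda>t. 1) = 1"
  using cfc_poly[of 1] by (simp add: one_pCons)

lemma cfc_cong:
  assumes "continuous_on {-1..1} f" "\<And>t. t \<in> {-1..1} \<Longrightarrow> f t = g t"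
  shows "cfc x f = cfc x g"
proof -
  obtain p where "poly_approx p f"
    using poly_approx_exists[OF assms(1)] ..
  then show ?thesis
    by (meson LIMSEQ_unique assms(2) cfc_tendsto poly_approx_cong)
qed

lemma cfc_add:
  assumes "continuous_on {-1..1} f" "continuous_on {-1..1} g"
  shows "cfc x (\<lambda>t. f t + g t) = cfc x f + cfc x g"
proof -
  obtain p q where pq: "poly_approx p f" "poly_approx q g"
    using assms poly_approx_exists by metis
  show ?thesis
    using cfc_tendsto[OF poly_approx_add[OF pq]] tendsto_add[OF pq[THEN cfc_tendsto]]
    unfolding poly_at_add by (rule LIMSEQ_unique)
qed

lemma cfc_mult:
  assumes "continuous_on {-1..1} f" "continuous_on {-1..1} g"
  shows "cfc x (\<lambda>t. f t * g t) = cfc x f * cfc x g"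
proof -
  obtain p q where pq: "poly_approx p f" "poly_approx q g"
    using assms poly_approx_exists by metis
  show ?thesis
    using cfc_tendsto[OF poly_approx_mult[OF pq assms]] tendsto_mult[OF pq[THEN cfc_tendsto]]
    unfolding poly_at_mult by (rule LIMSEQ_unique)
qed

lemma cfc_scaleC:
  assumes "continuous_on {-1..1} f"
  shows "cfc x (\<lambda>t. c * f t) = c *\<^sub>C cfc x f"
proof -
  obtain p where p: "poly_approx p f"
    using assms poly_approx_exists by metis
  show ?thesis
    using cfc_tendsto[OF poly_approx_smult[OF p]] tendsto_scaleC[OF cfc_tendsto[OF p]]
    unfolding poly_at_smult by (rule LIMSEQ_unique)
qed

lemma cfc_cnj:
  assumes "continuous_on {-1..1} f"
  shows "cfc x (\<lambda>t. cnj (f t)) = adj (cfc x f)"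
proof -
  obtain p where p: "poly_approx p f"
    using assms poly_approx_exists by metis
  show ?thesis
    using cfc_tendsto[OF poly_approx_cnj[OF p]] tendsto_adj[OF cfc_tendsto[OF p]]
    unfolding adj_poly_at[OF adj_x] by (rule LIMSEQ_unique)
qed

lemma cfc_commute:
  assumes "continuous_on {-1..1} f" "z * x = x * z"
  shows "z * cfc x f = cfc x f * z"
proof -
  obtain p where p: "poly_approx p f"
    using assms poly_approx_exists by metis
  show ?thesis
    using tendsto_mult_left[OF cfc_tendsto[OF p], of z] tendsto_mult_right[OF cfc_tendsto[OF p], of z]
    unfolding poly_at_commute[OF assms(2)] by (rule LIMSEQ_unique)
qed

lemma cfc_power:
  assumes "continuous_on {-1..1} f"
  shows "cfc x (\<lambda>t. f t ^ n) = cfc x f ^ n"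
proof (induction n)
  case (Suc n)
  then show ?case
    using cfc_mult[of f "\<lambda>t. f t ^ n"] assms by (simp add: continuous_on_power)
qed (simp add: cfc_one)

end

section \<open>Positivity\<close>

text \<open>The quasi square root b of y gives 1 - y^2 = (1 + b)^2, and 1 + b is a contraction. This
  bound stands for the positivity of y^2.\<close>

lemma norm_one_minus_square_le:
  fixes y :: "'a::unital_cstar_algebra"
  assumes "adj y = y" "norm y < 1"
  shows "norm (1 - y * y) \<le> 1"
proof -
  obtain b where b: "adj b = b" "y * b = b * y" "y * y + b * b + 2 *\<^sub>R b = 0"
    using quasi_sqrt_exists[OF assms] by blast
  have "1 - y * y = (1 + b) * (1 + b)"
    using b(3) by (simp add: algebra_simps scaleR_2)
  then show ?thesis
    using norm_le_one_plus_quasi_sqrt[OF assms(1) b] norm_mult_ineq[of "1 + b" "1 + b"]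
    by (metis mult_le_one norm_ge_zero order_trans)
qed

text \<open>This replaces the fact that a sum of squares is positive.\<close>

lemma sum_of_squares_lower_bound:
  fixes a b c :: "'a::unital_cstar_algebra"
  assumes "adj a = a" "adj b = b" "adj c = c"
  shows "\<exists>\<epsilon>>0. norm (1 - \<epsilon> *\<^sub>R (a * a + b * b + 2 *\<^sub>R (c * c))) \<le> 1"
proof -
  define d where "d = 1 / (1 + norm a + norm b + norm c)"
  have pos: "0 < 1 + norm a + norm b + norm c"
    using norm_ge_zero[of a] norm_ge_zero[of b] norm_ge_zero[of c] by linarith
  have d: "0 < d"
    using pos by (simp add: d_def)
  have sq: "norm (1 - (d * d) *\<^sub>R (y * y)) \<le> 1" if "y \<in> {a, b, c}" for y
  proof -
    have "norm y < 1 + norm a + norm b + norm c"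
      using that by (auto intro!: add_pos_nonneg add_nonneg_nonneg)
    then have "norm (d *\<^sub>R y) < 1"
      using d pos by (simp add: d_def)
    then show ?thesis
      using norm_one_minus_square_le[of "d *\<^sub>R y"] that assms by (auto simp: adj_scaleR)
  qed
  define A B C where "A = 1 - (d * d) *\<^sub>R (a * a)" and "B = 1 - (d * d) *\<^sub>R (b * b)"
    and "C = 1 - (d * d) *\<^sub>R (c * c)"
  have n: "norm A \<le> 1" "norm B \<le> 1" "norm C \<le> 1"
    using sq by (auto simp: A_def B_def C_def)
  have "norm ((A + B) + (C + C)) \<le> (norm A + norm B) + (norm C + norm C)"
    by (meson norm_triangle_le norm_triangle_ineq add_mono order_refl)
  \<comment> \<open>The average of four contractions is a contraction. C is taken twice to produce
    the coefficient 2, and averaging turns the scale d^2 into d^2 / 4.\<close>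
  moreover have "(A + B) + (C + C) = 4 *\<^sub>R (1 - (d * d / 4) *\<^sub>R (a * a + b * b + 2 *\<^sub>R (c * c)))"
  proof -
    have "4 *\<^sub>R (1::'a) = (1 + 1) + (1 + 1)"
      by (simp add: scaleR_2[symmetric] scaleR_add_left[symmetric])
    then show ?thesis
      by (simp add: A_def B_def C_def scaleR_diff_right scaleR_add_right scaleR_2)
  qed
  ultimately have "norm (1 - (d * d / 4) *\<^sub>R (a * a + b * b + 2 *\<^sub>R (c * c))) \<le> 1"
    using n by simp
  then show ?thesis
    using d by (intro exI[of _ "d * d / 4"]) auto
qed

text \<open>All powers of G(x), where G = 1 + \<epsilon> s >= 1, stay in the unit ball. Writing s =
  (s / G^M) G^M, Bernoulli's inequality bounds the first factor by 1 / (\<epsilon> M), so s(x) is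
  arbitrarily small.\<close>

lemma (in self_adjoint_contraction) cfc_eq_0_if_expanding:
  assumes "continuous_on {-1..1} s" "\<And>t. t \<in> {-1..1} \<Longrightarrow> 0 \<le> s t" "0 < \<epsilon>"
    and "norm (1 + \<epsilon> *\<^sub>R cfc x (\<lambda>t. complex_of_real (s t))) \<le> 1"
  shows "cfc x (\<lambda>t. complex_of_real (s t)) = 0"
proof -
  let ?F = "\<lambda>g. cfc x (\<lambda>t. complex_of_real (g t))"
  define G where "G = (\<lambda>t. 1 + \<epsilon> * s t)"
  have G: "continuous_on {-1..1} G" "\<And>t. t \<in> {-1..1} \<Longrightarrow> 1 \<le> G t"
    using assms(1-3) by (auto simp: G_def intro!: continuous_intros)
  have "?F G = 1 + \<epsilon> *\<^sub>R ?F s"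
    using assms(1) by (simp add: G_def cfc_add cfc_scaleC cfc_one scaleC_of_real continuous_intros)
  then have nG: "norm (?F G ^ N) \<le> 1" for N
    using assms(4) by (intro order_trans[OF norm_power_le] power_le_one) auto
  have cG: "continuous_on {-1..1} (\<lambda>t. complex_of_real (G t))"
    by (intro continuous_intros G(1))
  have frac: "b / p \<le> 1 / c" if "0 < c" "0 < p" "c * b \<le> p" for c p b :: real
    using that by (simp add: field_simps)
  have bound: "norm (?F s) \<le> 1 / (\<epsilon> * real (Suc N))" for N
  proof -
    let ?g = "\<lambda>t. s t / G t ^ Suc N"
    have cg: "continuous_on {-1..1} ?g"
      using G by (intro continuous_intros assms(1)) fastforce+
    have "?F s = cfc x (\<lambda>t. complex_of_real (?g t) * complex_of_real (G t) ^ Suc N)"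
    proof (rule cfc_cong)
      fix t :: real assume "t \<in> {-1..1}"
      then have "G t \<noteq> 0"
        using G(2) by force
      then show "complex_of_real (s t) = complex_of_real (?g t) * complex_of_real (G t) ^ Suc N"
        by (simp only: of_real_power[symmetric] of_real_mult[symmetric]) simp
    qed (intro continuous_intros assms(1))
    also have "\<dots> = ?F ?g * cfc x (\<lambda>t. complex_of_real (G t) ^ Suc N)"
      by (rule cfc_mult[OF continuous_on_of_real[OF cg] continuous_on_power[OF cG]])
    also have "\<dots> = ?F ?g * ?F G ^ Suc N"
      by (rule arg_cong[OF cfc_power[OF cG]])
    finally have "norm (?F s) \<le> norm (?F ?g) * norm (?F G ^ Suc N)"
      by (simp only: norm_mult_ineq)
    also have "\<dots> \<le> norm (?F ?g)"
      by (intro mult_left_le nG norm_ge_zero)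
    also have "norm (?F ?g) \<le> 1 / (\<epsilon> * real (Suc N))"
    proof (rule norm_cfc_le)
      fix t :: real assume t: "t \<in> {-1..1}"
      have "1 + real (Suc N) * (\<epsilon> * s t) \<le> G t ^ Suc N"
        unfolding G_def
      proof (rule Bernoulli_inequality)
        have "0 \<le> \<epsilon> * s t"
          using assms(2)[OF t] assms(3) by simp
        then show "- 1 \<le> \<epsilon> * s t"
          by linarith
      qed
      then have "\<epsilon> * real (Suc N) * s t \<le> G t ^ Suc N"
        by (simp add: mult_ac)
      moreover have "0 < G t ^ Suc N"
        using G(2)[OF t] by (intro zero_less_power) linarith
      ultimately have "?g t \<le> 1 / (\<epsilon> * real (Suc N))"
        using frac[of "\<epsilon> * real (Suc N)" "G t ^ Suc N" "s t"] assms(3) by simp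
      moreover have "0 \<le> ?g t"
        using assms(2)[OF t] \<open>0 < G t ^ Suc N\<close> by (simp del: power_Suc)
      ultimately show "cmod (complex_of_real (?g t)) \<le> 1 / (\<epsilon> * real (Suc N))"
        unfolding norm_of_real by simp
    qed (intro continuous_intros cg)
    finally show ?thesis
      by simp
  qed
  have "(\<lambda>N. (1 / \<epsilon>) * inverse (real (Suc N))) \<longlonglongrightarrow> (1 / \<epsilon>) * 0"
    by (intro tendsto_intros LIMSEQ_inverse_real_of_nat)
  then have "norm (?F s) \<le> 1 / \<epsilon> * 0"
    by (rule LIMSEQ_le_const) (use bound in \<open>auto simp: field_simps\<close>)
  then show ?thesis
    by simp
qed

text \<open>With \<open>g\<close> the negative part of \<open>h = k\<^sup>*k\<close> and \<open>z = k g\<close>, we have \<open>z\<^sup>*z = g h g = - g\<^sup>3\<close>, while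
  \<open>z\<^sup>*z + z z\<^sup>*\<close> is a sum of squares of self-adjoint elements. Since \<open>z\<^sup>*z\<close> is central in the algebra
  generated by \<open>k\<close>, this makes \<open>- 2 g\<^sup>6\<close> a sum of squares as well.\<close>

lemma negative_part_adj_mult_self:
  fixes k :: "'a::unital_cstar_algebra"
  assumes h: "h = adj k * k" and kh: "k * h = h * k" and norm_h: "norm h \<le> 1"
  shows "cfc h (\<lambda>t. complex_of_real (max 0 (- t))) = 0"
proof -
  have adj_h: "adj h = h"
    by (simp add: h adj_mult adj_adj)
  interpret self_adjoint_contraction h
    by unfold_locales (fact adj_h norm_h)+
  let ?F = "\<lambda>g. cfc h (\<lambda>t. complex_of_real (g t))"
  define n where "n = (\<lambda>t::real. max 0 (- t))"
  \<comment> \<open>The exponent 3/2 makes r^2 = n^3, so that - g^3 is - m^2 with m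
    self-adjoint.\<close>
  define r where "r = (\<lambda>t. sqrt (n t) ^ 3)"
  have cont: "continuous_on {-1..1} n" "continuous_on {-1..1} r"
    by (auto simp: n_def r_def intro!: continuous_intros)
  have F_mult: "?F (\<lambda>t. f t * g t) = ?F f * ?F g"
    if "continuous_on {-1..1} f" "continuous_on {-1..1} g" for f g
    using that cfc_mult[of "\<lambda>t. complex_of_real (f t)" "\<lambda>t. complex_of_real (g t)"]
    by (simp add: continuous_intros)
  have adj_F: "adj (?F f) = ?F f" if "continuous_on {-1..1} f" for f
    using that cfc_cnj[of "\<lambda>t. complex_of_real (f t)"] by (simp add: continuous_intros)
  have F_commute: "y * ?F f = ?F f * y" if "continuous_on {-1..1} f" "y * h = h * y" for f y
    using that by (intro cfc_commute) (auto intro!: continuous_intros)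
  define g m where "g = ?F n" and "m = ?F r"
  define z where "z = k * g"
  define w where "w = z * adj z"
  have adj_g: "adj g = g" and adj_m: "adj m = m"
    using adj_F cont by (simp_all add: g_def m_def)
  have km: "k * m = m * k"
    unfolding m_def by (rule F_commute[OF cont(2) kh])
  have gm: "g * m = m * g"
    unfolding g_def m_def by (simp only: F_mult[symmetric] cont mult.commute)
  have zm: "z * m = m * z"
    unfolding z_def using km gm by (metis mult.assoc)
  have adj_zm: "adj z * m = m * adj z"
    using arg_cong[OF zm, of adj] by (simp add: adj_mult adj_m)
  have n3: "n t * (n t * t) = - (r t * r t)" for t
  proof -
    have "r t * r t = (sqrt (n t) * sqrt (n t)) ^ 3"
      by (simp only: r_def power_mult_distrib)
    also have "\<dots> = n t ^ 3"
      by (simp add: n_def)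
    finally show ?thesis
      by (simp add: n_def max_def power3_eq_cube)
  qed
  have zz: "adj z * z = - (m * m)"
  proof -
    have "adj z * z = g * (adj k * k) * g"
      by (simp add: z_def adj_mult adj_g mult.assoc)
    also have "\<dots> = g * (g * h)"
      using F_commute[OF cont(1), of h] by (simp add: h[symmetric] g_def mult.assoc)
    also have "\<dots> = ?F (\<lambda>t. n t * (n t * t))"
      using cont by (simp add: F_mult continuous_intros cfc_id g_def del: of_real_mult)
    also have "\<dots> = ?F (\<lambda>t. (- 1) * (r t * r t))"
      by (simp add: n3)
    also have "\<dots> = (- 1) *\<^sub>C ?F (\<lambda>t. r t * r t)"
      using cont cfc_scaleC[of "\<lambda>t. complex_of_real (r t * r t)" "- 1"] by (simp add: continuous_intros)
    also have "\<dots> = - (m * m)"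
      using cont by (simp add: F_mult m_def del: of_real_mult)
    finally show ?thesis .
  qed
  \<comment> \<open>Up to factors 2 and -2 these are the real and imaginary parts of z, whence a^2 +
    b^2 is twice the sum of \<open>z * adj z\<close> and \<open>adj z * z\<close>.\<close>
  define a b where "a = z + adj z" and "b = \<i> *\<^sub>C (z - adj z)"
  have sa: "adj a = a" "adj b = b" "adj w = w"
    by (simp_all add: a_def b_def w_def adj_add adj_diff adj_scaleC adj_adj adj_mult
        scaleC_minus_left scaleC_diff_right add.commute)
  have am: "a * m = m * a" and bm: "b * m = m * b"
    using zm adj_zm
    by (simp_all add: a_def b_def distrib_left distrib_right left_diff_distrib right_diff_distrib
        scaleC_mult_left scaleC_mult_right)
  have "b * b = - ((z - adj z) * (z - adj z))"
    by (simp add: b_def scaleC_mult_left scaleC_mult_right scaleC_scaleC)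
  then have ab: "a * a + b * b = 2 *\<^sub>R (w - m * m)"
    using zz by (simp add: a_def w_def algebra_simps scaleR_2)
  have "w * w = z * (adj z * z) * adj z"
    by (simp add: w_def mult.assoc)
  also have "\<dots> = - (w * (m * m))"
    using zm adj_zm by (simp add: zz w_def) (metis mult.assoc)
  finally have ww: "w * w = - (w * (m * m))" .
  have "(a * m) * (a * m) + (b * m) * (b * m) = (a * a + b * b) * (m * m)"
    using am bm by (simp add: distrib_right) (metis mult.assoc)
  also have "\<dots> = 2 *\<^sub>R (w * (m * m) - m * m * (m * m))"
    by (simp add: ab left_diff_distrib)
  \<comment> \<open>Multiplying a^2 + b^2 by m^2 leaves the cross term 2 w m^2 = - 2 w^2. The added
    square 2 w^2 cancels it, and only - 2 m^4 remains.\<close>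
  finally have S: "(a * m) * (a * m) + (b * m) * (b * m) + 2 *\<^sub>R (w * w) = - (2 *\<^sub>R (m * m * (m * m)))"
    by (simp add: ww algebra_simps)
  obtain \<epsilon> where \<epsilon>: "0 < \<epsilon>" "norm (1 + (\<epsilon> * 2) *\<^sub>R (m * m * (m * m))) \<le> 1"
    using sum_of_squares_lower_bound[of "a * m" "b * m" w] sa am bm unfolding S
    by (auto simp: adj_mult adj_m)
  have mm: "m * m * (m * m) = ?F (\<lambda>t. r t * r t * (r t * r t))"
    using cont by (simp add: F_mult continuous_intros m_def del: of_real_mult)
  have "?F (\<lambda>t. r t * r t * (r t * r t)) = 0"
    using \<epsilon> cont by (intro cfc_eq_0_if_expanding[of _ "\<epsilon> * 2"]) (auto simp: mm[symmetric] simp del: of_real_mult intro!: continuous_intros)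
  \<comment> \<open>The C*-identity now extracts roots: m^4 = 0 gives m^2 = g^3 = 0, then g^4 = 0
    gives g^2 = 0 and g = 0.\<close>
  then have "m * m * (m * m) = 0"
    unfolding mm .
  then have "adj (m * m) * (m * m) = 0"
    by (simp only: adj_mult adj_m)
  then have "m * m = 0"
    unfolding adj_mult_self_eq_0 .
  moreover have "m * m = g * (g * g)"
  proof -
    have "r t * r t = n t * (n t * n t)" for t
      using n3[of t] by (auto simp: n_def max_def split: if_splits)
    then show ?thesis
      using cont by (simp add: F_mult[symmetric] continuous_intros g_def m_def del: of_real_mult)
  qed
  ultimately have "adj (g * g) * (g * g) = 0"
    by (simp add: adj_mult adj_g mult.assoc)
  then have "adj g * g = 0"
    unfolding adj_mult_self_eq_0 adj_g .
  then show ?thesis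
    unfolding adj_mult_self_eq_0 by (simp add: g_def n_def)
qed

section \<open>Multipliers\<close>

lemma cstar_subalgebraD:
  assumes "cstar_subalgebra C"
  shows "closed C" "0 \<in> C" "x \<in> C \<Longrightarrow> y \<in> C \<Longrightarrow> x + y \<in> C" "x \<in> C \<Longrightarrow> y \<in> C \<Longrightarrow> x * y \<in> C"
    "x \<in> C \<Longrightarrow> c *\<^sub>C x \<in> C" "x \<in> C \<Longrightarrow> adj x \<in> C"
  using assms by (auto simp: cstar_subalgebra_def)

lemma cstar_subalgebra_diff:
  assumes "cstar_subalgebra C" "x \<in> C" "y \<in> C"
  shows "x - y \<in> C"
  using cstar_subalgebraD(3)[OF assms(1,2) cstar_subalgebraD(5)[OF assms(1,3), of "- 1"]] by simp

text \<open>Test with z = \<open>adj (x - y)\<close>. This non-degeneracy does the work of a unit in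
  the identities between multipliers below.\<close>

lemma cstar_subalgebra_cancel_left:
  assumes "cstar_subalgebra C" "x \<in> C" "y \<in> C" "\<And>z. z \<in> C \<Longrightarrow> z * x = z * y"
  shows "x = y"
proof -
  have "adj (x - y) \<in> C"
    using assms by (intro cstar_subalgebraD(6) cstar_subalgebra_diff)
  then have "adj (x - y) * (x - y) = 0"
    using assms(4) by (simp add: right_diff_distrib)
  then show ?thesis
    by (simp add: adj_mult_self_eq_0)
qed

lemma cstar_subalgebra_cancel_right:
  assumes "cstar_subalgebra C" "x \<in> C" "y \<in> C" "\<And>z. z \<in> C \<Longrightarrow> x * z = y * z"
  shows "x = y"
proof -
  have "z * adj x = z * adj y" if "z \<in> C" for z
    using arg_cong[OF assms(4)[OF cstar_subalgebraD(6)[OF assms(1) that]], of adj]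
    by (simp add: adj_mult adj_adj)
  then have "adj x = adj y"
    using cstar_subalgebraD(6)[OF assms(1)] assms(2,3)
    by - (rule cstar_subalgebra_cancel_left[OF assms(1)]; blast)
  then show ?thesis
    by (metis adj_adj)
qed

text \<open>The remaining properties of a double centralizer follow from the intertwining relation.\<close>

definition centralizer_pair :: "'b::cstar_algebra set \<Rightarrow> ('b \<Rightarrow> 'b) \<Rightarrow> ('b \<Rightarrow> 'b) \<Rightarrow> bool" where
  "centralizer_pair C L R \<longleftrightarrow>
     (\<forall>x. L x \<in> C \<and> R x \<in> C) \<and> (\<forall>x. x \<notin> C \<longrightarrow> L x = 0 \<and> R x = 0) \<and>
     (\<forall>x\<in>C. \<forall>y\<in>C. R x * y = x * L y)"

lemma centralizer_pairD:
  assumes "centralizer_pair C L R"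
  shows "L x \<in> C" "R x \<in> C" "x \<notin> C \<Longrightarrow> L x = 0" "x \<notin> C \<Longrightarrow> R x = 0"
    "x \<in> C \<Longrightarrow> y \<in> C \<Longrightarrow> R x * y = x * L y"
  using assms by (auto simp: centralizer_pair_def)

text \<open>After multiplication by z from the left, L is traded for R z as a left factor, where
  each identity is an algebra law; z is then cancelled.\<close>

lemma centralizer_pair_left:
  assumes C: "cstar_subalgebra C" and LR: "centralizer_pair C L R"
    and x: "x \<in> C" and y: "y \<in> C"
  shows "L (x + y) = L x + L y" "L (x * y) = L x * y" "L (c *\<^sub>C x) = c *\<^sub>C L x"
proof -
  note D = cstar_subalgebraD[OF C] and E = centralizer_pairD[OF LR]
  have "z * L (x + y) = z * (L x + L y)" if "z \<in> C" for z
    using x y that by (simp add: E(5)[symmetric] D distrib_left)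
  then show "L (x + y) = L x + L y"
    using x y by - (rule cstar_subalgebra_cancel_left[OF C]; auto intro: D E)
  have "z * L (x * y) = z * (L x * y)" if "z \<in> C" for z
    using x y that by (simp add: E(5)[symmetric] D mult.assoc[symmetric])
  then show "L (x * y) = L x * y"
    using x y by - (rule cstar_subalgebra_cancel_left[OF C]; auto intro: D E)
  have "z * L (c *\<^sub>C x) = z * (c *\<^sub>C L x)" if "z \<in> C" for z
    using x y that by (simp add: E(5)[symmetric] D scaleC_mult_right)
  then show "L (c *\<^sub>C x) = c *\<^sub>C L x"
    using x y by - (rule cstar_subalgebra_cancel_left[OF C]; auto intro: D E)
qed

lemma centralizer_pair_right:
  assumes C: "cstar_subalgebra C" and LR: "centralizer_pair C L R"
    and x: "x \<in> C" and y: "y \<in> C"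
  shows "R (x + y) = R x + R y" "R (x * y) = x * R y" "R (c *\<^sub>C x) = c *\<^sub>C R x"
proof -
  note D = cstar_subalgebraD[OF C] and E = centralizer_pairD[OF LR]
  have "R (x + y) * z = (R x + R y) * z" if "z \<in> C" for z
    using x y that by (simp add: E(5) D distrib_right)
  then show "R (x + y) = R x + R y"
    using x y by - (rule cstar_subalgebra_cancel_right[OF C]; auto intro: D E)
  have "R (x * y) * z = (x * R y) * z" if "z \<in> C" for z
    using x y that by (simp add: E(5) D mult.assoc)
  then show "R (x * y) = x * R y"
    using x y by - (rule cstar_subalgebra_cancel_right[OF C]; auto intro: D E)
  have "R (c *\<^sub>C x) * z = (c *\<^sub>C R x) * z" if "z \<in> C" for z
    using x y that by (simp add: E(5) D scaleC_mult_left)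
  then show "R (c *\<^sub>C x) = c *\<^sub>C R x"
    using x y by - (rule cstar_subalgebra_cancel_right[OF C]; auto intro: D E)
qed

lemma centralizer_pair_zero:
  assumes "cstar_subalgebra C" "centralizer_pair C L R"
  shows "L 0 = 0" "R 0 = 0"
  using centralizer_pair_left(3)[OF assms, of 0 0 0] centralizer_pair_right(3)[OF assms, of 0 0 0]
    cstar_subalgebraD(2)[OF assms(1)] by simp_all

text \<open>With y = R x, the C*-identity and intertwining give that (norm y)^2 is the norm of
  \<open>x * L (adj y)\<close>, at most norm x times K norm y. Bounding left actions therefore
  suffices.\<close>

lemma centralizer_pair_norm_right:
  assumes C: "cstar_subalgebra C" and LR: "centralizer_pair C L R"
    and K: "\<And>x. norm (L x) \<le> K * norm x"
  shows "norm (R x) \<le> K * norm x"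
proof (cases "x \<in> C")
  case True
  note D = cstar_subalgebraD[OF C] and E = centralizer_pairD[OF LR]
  have "(norm (R x))\<^sup>2 = norm (x * L (adj (R x)))"
    using True by (simp add: E(5)[symmetric] E(2) D(6) cstar_identity')
  also have "\<dots> \<le> norm x * (K * norm (R x))"
    using K[of "adj (R x)"] by (intro order_trans[OF norm_mult_ineq] mult_left_mono) auto
  finally have "norm (R x) * norm (R x) \<le> (K * norm x) * norm (R x)"
    by (simp add: power2_eq_square mult_ac)
  moreover have "0 \<le> K * norm x"
    by (rule order_trans[OF norm_ge_zero K])
  ultimately show ?thesis
    by (cases "norm (R x) = 0") auto
next
  case False
  then show ?thesis
    using order_trans[OF norm_ge_zero K] centralizer_pairD(4)[OF LR False] by simp
qed

lemma multipliers_iff: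
  assumes C: "cstar_subalgebra C"
  shows "m \<in> multipliers C \<longleftrightarrow>
    centralizer_pair C (fst m) (snd m) \<and> (\<exists>K\<ge>0. \<forall>x. norm (fst m x) \<le> K * norm x)"
    (is "_ \<longleftrightarrow> ?P \<and> ?Q")
proof
  assume m: "m \<in> multipliers C"
  then have b: "bounded_clinear_within C (fst m)" "bounded_clinear_within C (snd m)"
    and i: "\<forall>x\<in>C. \<forall>y\<in>C. snd m x * y = x * fst m y"
    by (auto simp: multipliers_def)
  from b(1) obtain K where K: "\<And>x. x \<in> C \<Longrightarrow> norm (fst m x) \<le> K * norm x"
    unfolding bounded_clinear_within_def by blast
  have "T x \<in> C" "x \<notin> C \<Longrightarrow> T x = 0" if "bounded_clinear_within C T" for T x
    using that cstar_subalgebraD(2)[OF C] unfolding bounded_clinear_within_def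
    by (cases "x \<in> C"; simp)+
  then have P: ?P
    using b i unfolding centralizer_pair_def by simp
  have "norm (fst m x) \<le> \<bar>K\<bar> * norm x" for x
  proof (cases "x \<in> C")
    case True
    then show ?thesis
      using K[OF True] mult_right_mono[OF abs_ge_self[of K] norm_ge_zero[of x]] by linarith
  qed (simp add: centralizer_pairD(3)[OF P])
  then show "?P \<and> ?Q"
    using P by (intro conjI exI[of _ "\<bar>K\<bar>"]) auto
next
  assume "?P \<and> ?Q"
  then obtain K where P: ?P and K: "\<And>x. norm (fst m x) \<le> K * norm x"
    by blast
  have K': "norm (snd m x) \<le> K * norm x" for x
    by (rule centralizer_pair_norm_right[OF C P K])
  have "bounded_clinear_within C (fst m)" "bounded_clinear_within C (snd m)"
    unfolding bounded_clinear_within_def clinear_on_def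
    using centralizer_pairD[OF P] centralizer_pair_left[OF C P] centralizer_pair_right[OF C P] K K'
    by (auto intro!: exI[of _ K])
  then show "m \<in> multipliers C"
    using centralizer_pairD(5)[OF P] centralizer_pair_left(2)[OF C P] centralizer_pair_right(2)[OF C P]
    by (simp add: multipliers_def case_prod_beta)
qed

section \<open>Bounded families of multipliers as a unital \<open>C\<^sup>*\<close>-algebra\<close>

text \<open>There is no type of multipliers of a given subalgebra \<open>C\<close>. Bounded families of multipliers,
  indexed by all \<open>C\<^sup>*\<close>-subalgebras of \<open>'b\<close>, do form a type, and contain each multiplier algebra as
  the families supported at \<open>C\<close>. Other index sets are replaced by the zero algebra.\<close>

definition index_algebra :: "'b::cstar_algebra set \<Rightarrow> 'b set" where
  "index_algebra C = (if cstar_subalgebra C then C else {0})"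

lemma cstar_subalgebra_index_algebra: "cstar_subalgebra (index_algebra C)"
proof (cases "cstar_subalgebra C")
  case False
  then show ?thesis
    by (simp add: index_algebra_def cstar_subalgebra_def[of "{0}"])
qed (simp add: index_algebra_def)

lemmas index_algebra = cstar_subalgebraD[OF cstar_subalgebra_index_algebra]

text \<open>One constant K serves all index sets, which keeps the supremum in the norm
  finite.\<close>

definition multiplier_family ::
    "('b::cstar_algebra set \<Rightarrow> 'b \<Rightarrow> 'b) \<Rightarrow> ('b set \<Rightarrow> 'b \<Rightarrow> 'b) \<Rightarrow> bool" where
  "multiplier_family L R \<longleftrightarrow>
     (\<forall>C. centralizer_pair (index_algebra C) (L C) (R C)) \<and>
     (\<exists>K\<ge>0. \<forall>C x. norm (L C x) \<le> K * norm x)"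

lemma multiplier_family_zero: "multiplier_family (\<lambda>_ _. 0) (\<lambda>_ _. 0)"
  by (auto simp: multiplier_family_def centralizer_pair_def index_algebra)

typedef (overloaded) 'b mult_family =
  "{LR :: ('b::cstar_algebra set \<Rightarrow> 'b \<Rightarrow> 'b) \<times> ('b set \<Rightarrow> 'b \<Rightarrow> 'b).
     multiplier_family (fst LR) (snd LR)}"
  using multiplier_family_zero by fastforce

definition lact :: "'b::cstar_algebra mult_family \<Rightarrow> 'b set \<Rightarrow> 'b \<Rightarrow> 'b" where
  "lact m = fst (Rep_mult_family m)"

definition ract :: "'b::cstar_algebra mult_family \<Rightarrow> 'b set \<Rightarrow> 'b \<Rightarrow> 'b" where
  "ract m = snd (Rep_mult_family m)"

definition mk_family ::
    "('b::cstar_algebra set \<Rightarrow> 'b \<Rightarrow> 'b) \<Rightarrow> ('b set \<Rightarrow> 'b \<Rightarrow> 'b) \<Rightarrow> 'b mult_family" where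
  "mk_family L R = Abs_mult_family (L, R)"

lemma act_mk_family:
  assumes "multiplier_family L R"
  shows "lact (mk_family L R) = L" "ract (mk_family L R) = R"
  using assms by (simp_all add: lact_def ract_def mk_family_def Abs_mult_family_inverse)

lemma multiplier_family_act: "multiplier_family (lact m) (ract m)"
  using Rep_mult_family[of m] by (simp add: lact_def ract_def)

lemma centralizer_pair_act: "centralizer_pair (index_algebra C) (lact m C) (ract m C)"
  using multiplier_family_act[of m] by (simp add: multiplier_family_def)

lemma lact_bounded: "\<exists>K\<ge>0. \<forall>C x. norm (lact m C x) \<le> K * norm x"
  using multiplier_family_act[of m] by (simp add: multiplier_family_def)

lemmas act_simps [simp] =
  centralizer_pairD(1-4)[OF centralizer_pair_act]
  centralizer_pair_zero[OF cstar_subalgebra_index_algebra centralizer_pair_act]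

lemmas act_intertwine = centralizer_pairD(5)[OF centralizer_pair_act]
lemmas lact_linear =
  centralizer_pair_left[OF cstar_subalgebra_index_algebra centralizer_pair_act]

text \<open>The left action determines the right one by intertwining and cancellation, so algebraic
  laws are checked on left actions.\<close>

lemma mult_family_eqI:
  assumes "\<And>C x. x \<in> index_algebra C \<Longrightarrow> lact m C x = lact n C x"
  shows "m = n"
proof -
  have L: "lact m C x = lact n C x" for C x
    using assms by (cases "x \<in> index_algebra C") auto
  have "ract m C x = ract n C x" for C x
  proof (cases "x \<in> index_algebra C")
    case True
    then show ?thesis
      by - (rule cstar_subalgebra_cancel_right[OF cstar_subalgebra_index_algebra[of C]];
        simp add: act_intertwine L)
  qed auto
  then have "lact m = lact n" "ract m = ract n"
    by (simp_all add: fun_eq_iff L)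
  then show ?thesis
    by (simp add: lact_def ract_def prod_eq_iff flip: Rep_mult_family_inject)
qed

section \<open>Algebraic operations on bounded families\<close>

instantiation mult_family :: (cstar_algebra) "{zero, one, plus, minus, uminus, times, scaleR}"
begin

definition "0 = mk_family (\<lambda>_ _. 0) (\<lambda>_ _. 0)"

definition "1 = mk_family (\<lambda>C x. if x \<in> index_algebra C then x else 0)
  (\<lambda>C x. if x \<in> index_algebra C then x else 0)"

definition "m + n = mk_family (\<lambda>C x. lact m C x + lact n C x) (\<lambda>C x. ract m C x + ract n C x)"

definition "m * n = mk_family (\<lambda>C x. lact m C (lact n C x)) (\<lambda>C x. ract n C (ract m C x))"

definition "r *\<^sub>R m = mk_family (\<lambda>C x. r *\<^sub>R lact m C x) (\<lambda>C x. r *\<^sub>R ract m C x)"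

definition "- m = (- 1) *\<^sub>R (m :: 'a mult_family)"

definition "m - n = m + (- n :: 'a mult_family)"

instance ..

end

text \<open>At x = 0 the quotient is 0 by the convention on division; this pair also shows that the
  supremum is non-negative.\<close>

definition family_norm :: "'b::cstar_algebra mult_family \<Rightarrow> real" where
  "family_norm m = (SUP p. norm (lact m (fst p) (snd p)) / norm (snd p))"

lemma index_algebra_scaleR: "x \<in> index_algebra C \<Longrightarrow> r *\<^sub>R x \<in> index_algebra C"
  by (metis index_algebra(5) scaleC_of_real)

lemma act_zero [simp]: "lact 0 C x = 0" "ract 0 C x = 0"
  by (simp_all add: zero_mult_family_def act_mk_family multiplier_family_zero)

lemma act_one:
  "lact 1 C x = (if x \<in> index_algebra C then x else 0)"
  "ract 1 C x = (if x \<in> index_algebra C then x else 0)"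
proof -
  have "multiplier_family (\<lambda>C x. if x \<in> index_algebra C then x else 0)
      (\<lambda>C x::'a. if x \<in> index_algebra C then x else 0)"
    by (auto simp: multiplier_family_def centralizer_pair_def index_algebra intro!: exI[of _ 1])
  then show "lact 1 C x = (if x \<in> index_algebra C then x else 0)"
    "ract 1 C x = (if x \<in> index_algebra C then x else 0)"
    by (simp_all add: one_mult_family_def act_mk_family)
qed

lemma act_plus [simp]:
  "lact (m + n) C x = lact m C x + lact n C x"
  "ract (m + n) C x = ract m C x + ract n C x"
proof -
  obtain K K' where K: "0 \<le> K" "0 \<le> K'" "\<And>C x. norm (lact m C x) \<le> K * norm x"
    "\<And>C x. norm (lact n C x) \<le> K' * norm x"
    using lact_bounded[of m] lact_bounded[of n] by blast
  have "norm (lact m C x + lact n C x) \<le> (K + K') * norm x" for C x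
    unfolding distrib_right by (intro norm_triangle_le add_mono K)
  then have "multiplier_family (\<lambda>C x. lact m C x + lact n C x) (\<lambda>C x. ract m C x + ract n C x)"
    unfolding multiplier_family_def centralizer_pair_def using K(1,2)
    by (auto simp: index_algebra act_intertwine distrib_left distrib_right intro!: exI[of _ "K + K'"])
  then show "lact (m + n) C x = lact m C x + lact n C x" "ract (m + n) C x = ract m C x + ract n C x"
    by (simp_all add: plus_mult_family_def act_mk_family)
qed

lemma act_times [simp]:
  "lact (m * n) C x = lact m C (lact n C x)" "ract (m * n) C x = ract n C (ract m C x)"
proof -
  obtain K K' where K: "0 \<le> K" "0 \<le> K'" "\<And>C x. norm (lact m C x) \<le> K * norm x"
    "\<And>C x. norm (lact n C x) \<le> K' * norm x"
    using lact_bounded[of m] lact_bounded[of n] by blast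
  have "norm (lact m C (lact n C x)) \<le> (K * K') * norm x" for C x
    using order_trans[OF K(3) mult_left_mono[OF K(4) K(1)]] by (simp add: mult.assoc)
  then have "multiplier_family (\<lambda>C x. lact m C (lact n C x)) (\<lambda>C x. ract n C (ract m C x))"
    unfolding multiplier_family_def centralizer_pair_def using K(1,2)
    by (auto simp: act_intertwine intro!: exI[of _ "K * K'"])
  then show "lact (m * n) C x = lact m C (lact n C x)" "ract (m * n) C x = ract n C (ract m C x)"
    by (simp_all add: times_mult_family_def act_mk_family)
qed

lemma act_scaleR [simp]:
  "lact (r *\<^sub>R m) C x = r *\<^sub>R lact m C x" "ract (r *\<^sub>R m) C x = r *\<^sub>R ract m C x"
proof -
  obtain K where K: "0 \<le> K" "\<And>C x. norm (lact m C x) \<le> K * norm x"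
    using lact_bounded[of m] by blast
  have "norm (r *\<^sub>R lact m C x) \<le> (\<bar>r\<bar> * K) * norm x" for C x
    using mult_left_mono[OF K(2) abs_ge_zero[of r]] by (simp add: mult.assoc)
  then have "multiplier_family (\<lambda>C x. r *\<^sub>R lact m C x) (\<lambda>C x. r *\<^sub>R ract m C x)"
    unfolding multiplier_family_def centralizer_pair_def using K(1)
    by (auto simp: act_intertwine index_algebra_scaleR intro!: exI[of _ "\<bar>r\<bar> * K"])
  then show "lact (r *\<^sub>R m) C x = r *\<^sub>R lact m C x" "ract (r *\<^sub>R m) C x = r *\<^sub>R ract m C x"
    by (simp_all add: scaleR_mult_family_def act_mk_family)
qed

lemma act_minus [simp]:
  "lact (- m) C x = - lact m C x" "ract (- m) C x = - ract m C x"
  "lact (m - n) C x = lact m C x - lact n C x" "ract (m - n) C x = ract m C x - ract n C x"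
  by (simp_all add: uminus_mult_family_def minus_mult_family_def)

lemma family_norm_lact_le: "norm (lact m C x) \<le> family_norm m * norm x"
proof (cases "x = 0")
  case False
  obtain K where K: "0 \<le> K" "\<And>C x. norm (lact m C x) \<le> K * norm x"
    using lact_bounded[of m] by blast
  have "norm (lact m C x) / norm x \<le> family_norm m"
    unfolding family_norm_def
  proof (rule cSUP_upper2[of _ _ "(C, x)"])
    show "bdd_above (range (\<lambda>p. norm (lact m (fst p) (snd p)) / norm (snd p)))"
    proof (rule bdd_aboveI2)
      show "norm (lact m (fst p) (snd p)) / norm (snd p) \<le> K" for p
        using K by (cases "snd p = 0") (auto simp: divide_le_eq)
    qed
  qed auto
  then show ?thesis
    using False by (simp add: divide_le_eq)
qed auto

lemma family_norm_le:
  assumes "0 \<le> K" "\<And>C x. x \<in> index_algebra C \<Longrightarrow> norm (lact m C x) \<le> K * norm x"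
  shows "family_norm m \<le> K"
  unfolding family_norm_def
proof (rule cSUP_least)
  fix p :: "'a set \<times> 'a"
  have "norm (lact m (fst p) (snd p)) \<le> K * norm (snd p)"
    using assms by (cases "snd p \<in> index_algebra (fst p)") auto
  then show "norm (lact m (fst p) (snd p)) / norm (snd p) \<le> K"
    using assms(1) by (cases "snd p = 0") (auto simp: divide_le_eq)
qed auto

lemma family_norm_ract_le: "norm (ract m C x) \<le> family_norm m * norm x"
  by (rule centralizer_pair_norm_right[OF cstar_subalgebra_index_algebra centralizer_pair_act family_norm_lact_le])

lemma family_norm_ge_zero: "0 \<le> family_norm (m :: 'a::cstar_algebra mult_family)"
  unfolding family_norm_def
proof (rule cSUP_upper2[of _ _ "(undefined, 0)"])
  obtain K where K: "0 \<le> K" "\<And>C x. norm (lact m C x) \<le> K * norm x"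
    using lact_bounded[of m] by blast
  show "bdd_above (range (\<lambda>p. norm (lact m (fst p) (snd p)) / norm (snd p)))"
  proof (rule bdd_aboveI2)
    show "norm (lact m (fst p) (snd p)) / norm (snd p) \<le> K" for p
      using K by (cases "snd p = 0") (auto simp: divide_le_eq)
  qed
qed auto

section \<open>Norm and completeness of the algebra of families\<close>

instantiation mult_family :: (cstar_algebra) real_normed_algebra
begin

definition norm_mult_family :: "'a mult_family \<Rightarrow> real" where
  "norm_mult_family = family_norm"

definition sgn_mult_family :: "'a mult_family \<Rightarrow> 'a mult_family" where
  "sgn_mult_family m = inverse (family_norm m) *\<^sub>R m"

definition dist_mult_family :: "'a mult_family \<Rightarrow> 'a mult_family \<Rightarrow> real" where
  "dist_mult_family m n = family_norm (m - n)"

definition uniformity_mult_family :: "('a mult_family \<times> 'a mult_family) filter" where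
  "uniformity_mult_family = (INF e\<in>{0 <..}. principal {(m, n). dist m n < e})"

definition open_mult_family :: "'a mult_family set \<Rightarrow> bool" where
  "open_mult_family U \<longleftrightarrow> (\<forall>m\<in>U. eventually (\<lambda>(m', n). m' = m \<longrightarrow> n \<in> U) uniformity)"

instance
proof
  fix m n p :: "'a mult_family" and r s :: real
  show "m + n + p = m + (n + p)" "m + n = n + m" "0 + m = m" "- m + m = 0" "m - n = m + - n"
    "r *\<^sub>R (m + n) = r *\<^sub>R m + r *\<^sub>R n" "(r + s) *\<^sub>R m = r *\<^sub>R m + s *\<^sub>R m"
    "r *\<^sub>R s *\<^sub>R m = (r * s) *\<^sub>R m" "1 *\<^sub>R m = m"
    "m * n * p = m * (n * p)" "(m + n) * p = m * p + n * p"
    by (rule mult_family_eqI; simp add: algebra_simps)+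
  show "m * (n + p) = m * n + m * p"
    by (rule mult_family_eqI) (simp add: lact_linear)
  show "r *\<^sub>R m * n = r *\<^sub>R (m * n)"
    by (rule mult_family_eqI) simp
  show "m * r *\<^sub>R n = r *\<^sub>R (m * n)"
    by (rule mult_family_eqI) (simp add: scaleC_of_real[symmetric] lact_linear(3)[OF _ act_simps(1)])
  show "dist m n = norm (m - n)" "sgn m = inverse (norm m) *\<^sub>R m"
    by (simp_all add: dist_mult_family_def sgn_mult_family_def norm_mult_family_def)
  show "uniformity = (INF e\<in>{0 <..}. principal {(m :: 'a mult_family, n). dist m n < e})"
    by (rule uniformity_mult_family_def)
  show "open U \<longleftrightarrow> (\<forall>m\<in>U. eventually (\<lambda>(m', n). m' = m \<longrightarrow> n \<in> U) uniformity)"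
    for U :: "'a mult_family set"
    by (rule open_mult_family_def)
  have "family_norm m = 0 \<longleftrightarrow> m = 0"
  proof
    assume "family_norm m = 0"
    then show "m = 0"
      using family_norm_lact_le[of m] by (intro mult_family_eqI) simp
  next
    assume "m = 0"
    then have "family_norm m \<le> 0"
      by (intro family_norm_le) auto
    then show "family_norm m = 0"
      using family_norm_ge_zero[of m] by linarith
  qed
  then show "norm m = 0 \<longleftrightarrow> m = 0"
    by (simp only: norm_mult_family_def)
  have "family_norm (m + n) \<le> family_norm m + family_norm n"
    using family_norm_ge_zero[of m] family_norm_ge_zero[of n]
    by (intro family_norm_le)
      (auto simp: distrib_right intro!: norm_triangle_le add_mono family_norm_lact_le)
  then show "norm (m + n) \<le> norm m + norm n"
    by (simp only: norm_mult_family_def)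
  have "family_norm (m * n) \<le> family_norm m * family_norm n"
  proof (rule family_norm_le)
    fix C and x :: 'a
    show "norm (lact (m * n) C x) \<le> family_norm m * family_norm n * norm x"
      using order_trans[OF family_norm_lact_le[of m C "lact n C x"]
          mult_left_mono[OF family_norm_lact_le[of n C x] family_norm_ge_zero[of m]]]
      by (simp add: mult.assoc)
  qed (simp add: family_norm_ge_zero)
  then show "norm (m * n) \<le> norm m * norm n"
    by (simp only: norm_mult_family_def)
  \<comment> \<open>Applied to \<open>inverse r\<close> and the scaled family, this inequality also
    yields its converse.\<close>
  have le: "family_norm (s *\<^sub>R m) \<le> \<bar>s\<bar> * family_norm m" for s and m :: "'a mult_family"
    using family_norm_ge_zero[of m]
    by (intro family_norm_le) (auto simp: mult.assoc intro!: mult_left_mono family_norm_lact_le)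
  have "family_norm (r *\<^sub>R m) = \<bar>r\<bar> * family_norm m"
  proof (cases "r = 0")
    case True
    then show ?thesis
      using le[of r m] family_norm_ge_zero[of "r *\<^sub>R m"] by simp
  next
    case False
    have "inverse r *\<^sub>R r *\<^sub>R m = m"
      by (rule mult_family_eqI) (simp add: False)
    then have "family_norm m \<le> \<bar>inverse r\<bar> * family_norm (r *\<^sub>R m)"
      using le[of "inverse r" "r *\<^sub>R m"] by simp
    then have "\<bar>r\<bar> * family_norm m \<le> family_norm (r *\<^sub>R m)"
      using False by (simp add: field_simps)
    then show ?thesis
      using le[of r m] by linarith
  qed
  then show "norm (r *\<^sub>R m) = \<bar>r\<bar> * norm m"
    by (simp only: norm_mult_family_def)
qed

end

lemmas norm_lact_le = family_norm_lact_le[folded norm_mult_family_def]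
lemmas norm_ract_le = family_norm_ract_le[folded norm_mult_family_def]
lemmas norm_mult_family_le = family_norm_le[folded norm_mult_family_def]

text \<open>The limit is taken pointwise in both actions. Values stay in the closed index algebras,
  intertwining passes to the limit, and a norm bound of the Cauchy sequence is the uniform
  constant.\<close>

instance mult_family :: (cstar_algebra) banach
proof
  fix X :: "nat \<Rightarrow> 'a mult_family"
  assume X: "Cauchy X"
  obtain K where K: "0 < K" "\<And>n. norm (X n) \<le> K"
    using Cauchy_Bseq[OF X] by (auto simp: Bseq_def)
  have lip: "norm (lact (X i) C x - lact (X j) C x) \<le> norm (X i - X j) * norm x"
    "norm (ract (X i) C x - ract (X j) C x) \<le> norm (X i - X j) * norm x" for i j C x
    using norm_lact_le[of "X i - X j" C x] norm_ract_le[of "X i - X j" C x] by simp_all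
  have cauchy: "Cauchy (\<lambda>n. F n)" if F: "\<And>i j. norm (F i - F j) \<le> norm (X i - X j) * norm x"
    for F :: "nat \<Rightarrow> 'a" and x :: 'a
  proof (rule CauchyI)
    fix e :: real assume "0 < e"
    \<comment> \<open>The summand 1 covers x = 0.\<close>
    have pos: "0 < 1 + norm x"
      using norm_ge_zero[of x] by linarith
    obtain N where N: "\<And>i j. i \<ge> N \<Longrightarrow> j \<ge> N \<Longrightarrow> norm (X i - X j) < e / (1 + norm x)"
      using X \<open>0 < e\<close> pos unfolding Cauchy_iff by (meson divide_pos_pos)
    have "norm (F i - F j) < e" if "i \<ge> N" "j \<ge> N" for i j
    proof -
      have "norm (F i - F j) \<le> norm (X i - X j) * (1 + norm x)"
        using F[of i j] by (simp add: distrib_left add_increasing)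
      also have "\<dots> < e"
        using N[OF that] pos by (simp add: pos_less_divide_eq)
      finally show ?thesis .
    qed
    then show "\<exists>M. \<forall>i\<ge>M. \<forall>j\<ge>M. norm (F i - F j) < e"
      by blast
  qed
  define L R where "L C x = lim (\<lambda>n. lact (X n) C x)" and "R C x = lim (\<lambda>n. ract (X n) C x)" for C x
  have L: "(\<lambda>n. lact (X n) C x) \<longlonglongrightarrow> L C x" and R: "(\<lambda>n. ract (X n) C x) \<longlonglongrightarrow> R C x" for C x
    using cauchy[OF lip(1)] cauchy[OF lip(2)]
    by (simp_all add: L_def R_def Cauchy_convergent flip: convergent_LIMSEQ_iff)
  have fam: "multiplier_family L R"
    unfolding multiplier_family_def centralizer_pair_def
  proof (intro conjI allI impI ballI exI[of _ K])
    fix C and x :: 'a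
    show "L C x \<in> index_algebra C" "R C x \<in> index_algebra C"
      by (rule closed_sequentially[OF index_algebra(1) _ L] closed_sequentially[OF index_algebra(1) _ R]; simp)+
    show "norm (L C x) \<le> K * norm x"
      by (rule LIMSEQ_le_const2[OF tendsto_norm[OF L]])
        (meson K(2) mult_right_mono norm_ge_zero norm_lact_le order_trans)
    show "L C x = 0" "R C x = 0" if "x \<notin> index_algebra C"
      using L[of C x] R[of C x] that by (simp_all add: LIMSEQ_const_iff)
    show "R C x * y = x * L C y" if "x \<in> index_algebra C" "y \<in> index_algebra C" for y
      using tendsto_mult_right[OF R[of C x], of y] tendsto_mult_left[OF L[of C y], of x]
      unfolding act_intertwine[OF that] by (rule LIMSEQ_unique)
  qed (use K(1) in simp)
  define m where "m = mk_family L R"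
  have m: "lact m = L"
    by (simp add: m_def act_mk_family fam)
  have "X \<longlonglongrightarrow> m"
  proof (rule LIMSEQ_I)
    fix e :: real assume "0 < e"
    then obtain N where N: "\<And>i j. i \<ge> N \<Longrightarrow> j \<ge> N \<Longrightarrow> norm (X i - X j) < e / 2"
      using X unfolding Cauchy_iff by (meson half_gt_zero)
    have "norm (X i - m) \<le> e / 2" if "i \<ge> N" for i
    proof (rule norm_mult_family_le)
      fix C and x :: 'a
      have "(\<lambda>j. norm (lact (X i) C x - lact (X j) C x)) \<longlonglongrightarrow> norm (lact (X i) C x - L C x)"
        by (intro tendsto_intros L)
      moreover have "norm (lact (X i) C x - lact (X j) C x) \<le> e / 2 * norm x" if "j \<ge> N" for j
        using lip(1)[of i C x j] N[OF \<open>i \<ge> N\<close> that]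
        by (meson less_imp_le mult_right_mono norm_ge_zero order_trans)
      ultimately show "norm (lact (X i - m) C x) \<le> e / 2 * norm x"
        unfolding act_minus m by (intro LIMSEQ_le_const2) blast+
    qed (use \<open>0 < e\<close> in simp)
    then show "\<exists>N. \<forall>n\<ge>N. norm (X n - m) < e"
      using \<open>0 < e\<close> by (intro exI[of _ N]) (metis half_gt_zero_iff field_sum_of_halves less_add_same_cancel1 order_le_less_trans)
  qed
  then show "convergent X"
    by (rule convergentI)
qed

section \<open>Involution and C*-identity for families\<close>

instantiation mult_family :: (cstar_algebra) unital_cstar_algebra
begin

definition scaleC_mult_family :: "complex \<Rightarrow> 'a mult_family \<Rightarrow> 'a mult_family" where
  "c *\<^sub>C m = mk_family (\<lambda>C x. c *\<^sub>C lact m C x) (\<lambda>C x. c *\<^sub>C ract m C x)"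

definition adj_mult_family :: "'a mult_family \<Rightarrow> 'a mult_family" where
  "adj m = mk_family (\<lambda>C x. adj (ract m C (adj x))) (\<lambda>C x. adj (lact m C (adj x)))"

lemma act_scaleC [simp]:
  "lact (c *\<^sub>C m) C x = c *\<^sub>C lact m C x" "ract (c *\<^sub>C m) C x = c *\<^sub>C ract m C x"
proof -
  have "norm (c *\<^sub>C lact m C x) \<le> (cmod c * norm m) * norm x" for C x
    using mult_left_mono[OF norm_lact_le norm_ge_zero[of c]] by (simp add: mult.assoc norm_scaleC)
  then have "multiplier_family (\<lambda>C x. c *\<^sub>C lact m C x) (\<lambda>C x. c *\<^sub>C ract m C x)"
    unfolding multiplier_family_def centralizer_pair_def
    by (auto simp: act_intertwine index_algebra scaleC_mult_left scaleC_mult_right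
        intro!: exI[of _ "cmod c * norm m"])
  then show "lact (c *\<^sub>C m) C x = c *\<^sub>C lact m C x" "ract (c *\<^sub>C m) C x = c *\<^sub>C ract m C x"
    by (simp_all add: scaleC_mult_family_def act_mk_family)
qed

lemma act_adj [simp]:
  "lact (adj m) C x = adj (ract m C (adj x))" "ract (adj m) C x = adj (lact m C (adj x))"
proof -
  have "centralizer_pair (index_algebra C) (\<lambda>x. adj (ract m C (adj x))) (\<lambda>x. adj (lact m C (adj x)))" for C
    unfolding centralizer_pair_def
  proof (intro conjI allI impI ballI)
    fix x y
    show "adj (ract m C (adj x)) \<in> index_algebra C" "adj (lact m C (adj x)) \<in> index_algebra C"
      by (simp_all add: index_algebra)
    show "adj (ract m C (adj x)) = 0" "adj (lact m C (adj x)) = 0" if "x \<notin> index_algebra C"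
    proof -
      have "adj x \<notin> index_algebra C"
        using that index_algebra(6)[of "adj x" C] by (auto simp: adj_adj)
      then show "adj (ract m C (adj x)) = 0" "adj (lact m C (adj x)) = 0"
        by simp_all
    qed
    assume "x \<in> index_algebra C" "y \<in> index_algebra C"
    then have "adj (ract m C (adj y) * adj x) = adj (adj y * lact m C (adj x))"
      by (simp add: act_intertwine index_algebra)
    then show "adj (lact m C (adj x)) * y = x * adj (ract m C (adj y))"
      by (simp add: adj_mult adj_adj)
  qed
  moreover have "norm (adj (ract m C (adj x))) \<le> norm m * norm x" for C x
    using norm_ract_le[of m C "adj x"] by simp
  ultimately have "multiplier_family (\<lambda>C x. adj (ract m C (adj x))) (\<lambda>C x. adj (lact m C (adj x)))"
    unfolding multiplier_family_def by (intro conjI exI[of _ "norm m"]) auto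
  then show "lact (adj m) C x = adj (ract m C (adj x))" "ract (adj m) C x = adj (lact m C (adj x))"
    by (simp_all add: adj_mult_family_def act_mk_family)
qed

instance
proof
  fix m n :: "'a mult_family" and c d :: complex and r :: real
  show "1 * m = m"
    by (rule mult_family_eqI) (simp add: act_one)
  show "m * 1 = m"
    by (rule mult_family_eqI) (simp add: act_one)
  show "c *\<^sub>C (m + n) = c *\<^sub>C m + c *\<^sub>C n"
    by (rule mult_family_eqI) (simp add: scaleC_add_right)
  show "(c + d) *\<^sub>C m = c *\<^sub>C m + d *\<^sub>C m"
    by (rule mult_family_eqI) (simp add: scaleC_add_left)
  show "c *\<^sub>C d *\<^sub>C m = (c * d) *\<^sub>C m"
    by (rule mult_family_eqI) (simp add: scaleC_scaleC)
  show "complex_of_real r *\<^sub>C m = r *\<^sub>R m"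
    by (rule mult_family_eqI) (simp add: scaleC_of_real)
  show "c *\<^sub>C m * n = c *\<^sub>C (m * n)"
    by (rule mult_family_eqI) simp
  show "m * c *\<^sub>C n = c *\<^sub>C (m * n)"
    by (rule mult_family_eqI) (simp add: lact_linear(3)[OF _ act_simps(1)])
  show "adj (m + n) = adj m + adj n"
    by (rule mult_family_eqI) (simp add: adj_add)
  show "adj (c *\<^sub>C m) = cnj c *\<^sub>C adj m"
    by (rule mult_family_eqI) (simp add: adj_scaleC)
  show "adj (m * n) = adj n * adj m"
    by (rule mult_family_eqI) (simp add: adj_adj)
  show adj_adj_m: "adj (adj m) = m" for m :: "'a mult_family"
    by (rule mult_family_eqI) (simp add: adj_adj)
  have scale_le: "norm (c *\<^sub>C m) \<le> cmod c * norm m" for c and m :: "'a mult_family"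
    by (rule norm_mult_family_le)
      (auto simp: mult.assoc norm_scaleC intro!: mult_left_mono norm_lact_le)
  show "norm (c *\<^sub>C m) = cmod c * norm m"
  proof (cases "c = 0")
    case True
    then show ?thesis
      using scale_le[of c m] by simp
  next
    case False
    have "inverse c *\<^sub>C c *\<^sub>C m = m"
      by (rule mult_family_eqI) (simp add: False scaleC_scaleC)
    then have "norm m \<le> cmod (inverse c) * norm (c *\<^sub>C m)"
      using scale_le[of "inverse c" "c *\<^sub>C m"] by simp
    then have "cmod c * norm m \<le> norm (c *\<^sub>C m)"
      using False by (simp add: norm_inverse inverse_eq_divide norm_divide field_simps)
    then show ?thesis
      using scale_le[of c m] by linarith
  qed
  have adj_le: "norm (adj m) \<le> norm m" for m :: "'a mult_family"
    using norm_ract_le[of m] by (intro norm_mult_family_le) (auto, metis norm_adj)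
  have "norm (adj m * m) \<le> norm m * norm m"
    by (meson adj_le mult_right_mono norm_ge_zero norm_mult_ineq order_trans)
  \<comment> \<open>The adjoint of m x is the right action of \<open>adj m\<close> on
    \<open>adj x\<close>. Intertwining moves \<open>adj m\<close> to the other factor, so the square
    of norm (m x) is the norm of \<open>adj x\<close> times the image of x under
    \<open>adj m * m\<close>.\<close>
  moreover have "norm m \<le> sqrt (norm (adj m * m))"
  proof (rule norm_mult_family_le)
    fix C and x :: 'a assume x: "x \<in> index_algebra C"
    have "adj (lact m C x) * lact m C x = ract (adj m) C (adj x) * lact m C x"
      by (simp add: adj_adj)
    also have "\<dots> = adj x * lact (adj m * m) C x"
      using x by (simp only: act_intertwine index_algebra act_simps act_times)
    finally have "(norm (lact m C x))\<^sup>2 = norm (adj x * lact (adj m * m) C x)"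
      by (simp only: cstar_identity[symmetric])
    also have "\<dots> \<le> norm x * (norm (adj m * m) * norm x)"
      using norm_mult_ineq[of "adj x" "lact (adj m * m) C x"]
        mult_left_mono[OF norm_lact_le[of "adj m * m" C x] norm_ge_zero[of x]]
      unfolding norm_adj by linarith
    also have "\<dots> = (sqrt (norm (adj m * m)) * norm x)\<^sup>2"
      by (simp add: power_mult_distrib power2_eq_square mult_ac)
    finally show "norm (lact m C x) \<le> sqrt (norm (adj m * m)) * norm x"
      by (rule power2_le_imp_le) simp
  qed simp
  then have "(norm m)\<^sup>2 \<le> (sqrt (norm (adj m * m)))\<^sup>2"
    by (rule power_mono) simp
  ultimately show "norm (adj m * m) = (norm m)\<^sup>2"
    by (simp add: power2_eq_square)
qed

end

section \<open>The multiplier algebra inside the algebra of families\<close>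

definition component :: "'b::cstar_algebra mult_family \<Rightarrow> 'b set \<Rightarrow> 'b centralizer" where
  "component m C = (lact m C, ract m C)"

lemma component_simps:
  "component (m + n) C = M_add (component m C) (component n C)"
  "component (m * n) C = M_mult (component m C) (component n C)"
  "component (c *\<^sub>C m) C = M_scale c (component m C)"
  "component (adj m) C = M_adj (component m C)"
  by (simp_all add: component_def M_add_def M_mult_def M_scale_def M_adj_def fun_eq_iff)

locale cstar_subalgebra_locale =
  fixes C :: "'b::cstar_algebra set"
  assumes subalgebra: "cstar_subalgebra C"
begin

lemma index_algebra_C [simp]: "index_algebra C = C"
  by (simp add: index_algebra_def subalgebra)

lemma component_in_multipliers: "component m C \<in> multipliers C"
  using centralizer_pair_act[of C m] lact_bounded[of m]
  unfolding multipliers_iff[OF subalgebra] by (auto simp: component_def)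

text \<open>Extension by zero to the other index sets. It respects products and adjoints but in
  general not the unit, so it suits functions vanishing at 0 and not constants.\<close>

definition \<iota> :: "'b centralizer \<Rightarrow> 'b mult_family" where
  "\<iota> m = mk_family (\<lambda>D. if D = C then fst m else (\<lambda>_. 0)) (\<lambda>D. if D = C then snd m else (\<lambda>_. 0))"

lemma act_\<iota>:
  assumes "m \<in> multipliers C"
  shows "lact (\<iota> m) D x = (if D = C then fst m x else 0)"
    "ract (\<iota> m) D x = (if D = C then snd m x else 0)"
proof -
  obtain K where K: "centralizer_pair C (fst m) (snd m)" "0 \<le> K" "\<And>x. norm (fst m x) \<le> K * norm x"
    using assms unfolding multipliers_iff[OF subalgebra] by blast
  have "centralizer_pair (index_algebra D) (\<lambda>_. 0) (\<lambda>_. 0)" for D :: "'b set"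
    by (simp add: centralizer_pair_def index_algebra)
  then have "multiplier_family (\<lambda>D. if D = C then fst m else (\<lambda>_. 0)) (\<lambda>D. if D = C then snd m else (\<lambda>_. 0))"
    unfolding multiplier_family_def using K by (auto intro!: exI[of _ K])
  then show "lact (\<iota> m) D x = (if D = C then fst m x else 0)"
    "ract (\<iota> m) D x = (if D = C then snd m x else 0)"
    by (simp_all add: \<iota>_def act_mk_family)
qed

lemma component_\<iota>: "m \<in> multipliers C \<Longrightarrow> component (\<iota> m) C = m"
  by (simp add: component_def act_\<iota> prod_eq_iff fun_eq_iff)

lemma \<iota>_component:
  assumes "\<And>D x. D \<noteq> C \<Longrightarrow> lact m D x = 0"
  shows "\<iota> (component m C) = m"
  by (rule mult_family_eqI, unfold act_\<iota>[OF component_in_multipliers])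
    (simp add: component_def assms)

text \<open>Inherited from the families: each operation on multipliers is the component at C of the
  operation on their extensions.\<close>

lemma multipliers_closed:
  assumes "m \<in> multipliers C"
  shows "n \<in> multipliers C \<Longrightarrow> M_add m n \<in> multipliers C"
    "n \<in> multipliers C \<Longrightarrow> M_mult m n \<in> multipliers C"
    "M_scale c m \<in> multipliers C" "M_adj m \<in> multipliers C"
  using component_in_multipliers[of "\<iota> m + \<iota> n"] component_in_multipliers[of "\<iota> m * \<iota> n"]
    component_in_multipliers[of "c *\<^sub>C \<iota> m"] component_in_multipliers[of "adj (\<iota> m)"]
  by (simp_all add: component_simps component_\<iota> assms)

lemma \<iota>_simps:
  assumes "m \<in> multipliers C"
  shows "n \<in> multipliers C \<Longrightarrow> \<iota> (M_add m n) = \<iota> m + \<iota> n"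
    "n \<in> multipliers C \<Longrightarrow> \<iota> (M_mult m n) = \<iota> m * \<iota> n"
    "\<iota> (M_scale c m) = c *\<^sub>C \<iota> m" "\<iota> (M_adj m) = adj (\<iota> m)"
  using \<iota>_component[of "\<iota> m + \<iota> n"] \<iota>_component[of "\<iota> m * \<iota> n"]
    \<iota>_component[of "c *\<^sub>C \<iota> m"] \<iota>_component[of "adj (\<iota> m)"]
  by (simp_all add: component_simps component_\<iota> act_\<iota> assms)

section \<open>C inside its multiplier algebra\<close>

lemma M_embed_in_multipliers:
  assumes "c \<in> C"
  shows "M_embed C c \<in> multipliers C"
proof -
  have "centralizer_pair C (fst (M_embed C c)) (snd (M_embed C c))"
    using assms by (auto simp: centralizer_pair_def M_embed_def mult.assoc
        intro: cstar_subalgebraD[OF subalgebra])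
  then show ?thesis
    unfolding multipliers_iff[OF subalgebra]
    by (auto simp: M_embed_def norm_mult_ineq intro!: exI[of _ "norm c"])
qed

definition emb :: "'b \<Rightarrow> 'b mult_family" where
  "emb c = \<iota> (M_embed C c)"

lemma lact_emb: "c \<in> C \<Longrightarrow> lact (emb c) D x = (if D = C \<and> x \<in> C then c * x else 0)"
  unfolding emb_def by (subst act_\<iota>[OF M_embed_in_multipliers]) (auto simp: M_embed_def)

lemma lact_in [simp]: "lact m C x \<in> C"
  using act_simps(1)[of m C x] by simp

text \<open>The image of C is a left ideal; this is what brings p(h) \<phi>(a) back into C.\<close>

lemma mult_emb:
  assumes "c \<in> C"
  shows "m * emb c = emb (lact m C c)"
  by (rule mult_family_eqI) (use assms lact_linear(2)[of c C _ m] in \<open>auto simp: lact_emb\<close>)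

lemma emb_mult: "c \<in> C \<Longrightarrow> d \<in> C \<Longrightarrow> emb (c * d) = emb c * emb d"
  by (simp add: mult_emb lact_emb)

lemma emb_add: "c \<in> C \<Longrightarrow> d \<in> C \<Longrightarrow> emb (c + d) = emb c + emb d"
  by (rule mult_family_eqI) (simp add: lact_emb cstar_subalgebraD[OF subalgebra] distrib_right)

lemma emb_scaleC: "c \<in> C \<Longrightarrow> emb (z *\<^sub>C c) = z *\<^sub>C emb c"
  by (rule mult_family_eqI) (simp add: lact_emb cstar_subalgebraD[OF subalgebra] scaleC_mult_left)

lemma emb_diff: "c \<in> C \<Longrightarrow> d \<in> C \<Longrightarrow> emb (c - d) = emb c - emb d"
  by (rule mult_family_eqI) (simp add: lact_emb cstar_subalgebra_diff[OF subalgebra] left_diff_distrib)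

lemma emb_adj: "c \<in> C \<Longrightarrow> emb (adj c) = adj (emb c)"
proof -
  assume c: "c \<in> C"
  have "ract (emb c) D x = (if D = C \<and> x \<in> C then x * c else 0)" for D x
    unfolding emb_def by (subst act_\<iota>[OF M_embed_in_multipliers[OF c]]) (auto simp: M_embed_def)
  then show ?thesis
    using c by (intro mult_family_eqI)
      (auto simp: lact_emb cstar_subalgebraD[OF subalgebra] adj_mult adj_adj)
qed

lemma norm_emb:
  assumes c: "c \<in> C"
  shows "norm (emb c) = norm c"
proof (rule antisym)
  show "norm (emb c) \<le> norm c"
    using c by (intro norm_mult_family_le) (auto simp: lact_emb norm_mult_ineq)
  have "norm c * norm c \<le> norm (emb c) * norm c"
    using norm_lact_le[of "emb c" C "adj c"] c
    by (simp add: lact_emb cstar_subalgebraD[OF subalgebra] cstar_identity' power2_eq_square)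
  then show "norm c \<le> norm (emb c)"
    by (cases "norm c = 0") auto
qed

lemma emb_eq_iff: "c \<in> C \<Longrightarrow> d \<in> C \<Longrightarrow> emb c = emb d \<longleftrightarrow> c = d"
  using norm_emb[of "c - d"] emb_diff[of c d] cstar_subalgebra_diff[OF subalgebra, of c d] by auto

text \<open>The isometric image of a complete set is closed. Limits of elements of C found among the
  multipliers thus remain in C.\<close>

lemma closed_emb: "closed (emb ` C)"
  unfolding closed_sequential_limits
proof (intro allI impI, elim conjE)
  fix X l assume X: "\<forall>n. X n \<in> emb ` C" "X \<longlonglongrightarrow> l"
  then obtain c where c: "\<And>n. c n \<in> C" "\<And>n. X n = emb (c n)"
    by (auto simp: image_iff) metis
  have "norm (c i - c j) = norm (X i - X j)" for i j
    by (simp add: c emb_diff[symmetric] norm_emb cstar_subalgebra_diff[OF subalgebra])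
  then have "Cauchy c"
    using LIMSEQ_imp_Cauchy[OF X(2)] by (simp add: Cauchy_iff)
  then obtain d where d: "c \<longlonglongrightarrow> d"
    using Cauchy_convergent_iff convergent_def by blast
  have "d \<in> C"
    by (rule closed_sequentially[OF cstar_subalgebraD(1)[OF subalgebra] _ d]) (rule c(1))
  have "norm (X n - emb d) = norm (c n - d)" for n
    using \<open>d \<in> C\<close> by (simp add: c emb_diff[symmetric] norm_emb cstar_subalgebra_diff[OF subalgebra])
  then have "X \<longlonglongrightarrow> emb d"
    using d unfolding LIMSEQ_iff by simp
  then show "l \<in> emb ` C"
    using LIMSEQ_unique[OF X(2)] \<open>d \<in> C\<close> by blast
qed

text \<open>Commutation with C extends to all multipliers: on a product x y both orders of h and k
  give k(x) h(y), and y is cancelled.\<close>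

lemma central_multiplier:
  assumes h: "h \<in> multipliers C" and k: "k \<in> multipliers C"
    and hC: "\<And>c. c \<in> C \<Longrightarrow> M_mult h (M_embed C c) = M_mult (M_embed C c) h"
  shows "\<iota> k * \<iota> h = \<iota> h * \<iota> k"
proof (rule mult_family_eqI)
  fix D and x :: 'b assume x: "x \<in> index_algebra D"
  show "lact (\<iota> k * \<iota> h) D x = lact (\<iota> h * \<iota> k) D x"
  proof (cases "D = C")
    case True
    then have x: "x \<in> C"
      using x by simp
    have P: "centralizer_pair C (fst h) (snd h)" "centralizer_pair C (fst k) (snd k)"
      using h k by (simp_all add: multipliers_iff[OF subalgebra])
    note H = centralizer_pairD[OF P(1)] centralizer_pair_left[OF subalgebra P(1)]
    note K = centralizer_pairD[OF P(2)] centralizer_pair_left[OF subalgebra P(2)]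
    have comm: "fst h (c * y) = c * fst h y" if "c \<in> C" "y \<in> C" for c y
    proof -
      have "fst (M_mult h (M_embed C c)) y = fst (M_mult (M_embed C c) h) y"
        using hC[OF that(1)] by simp
      then show ?thesis
        using that H(1) by (simp add: M_mult_def M_embed_def)
    qed
    have "fst k (fst h x) = fst h (fst k x)"
    proof (rule cstar_subalgebra_cancel_right[OF subalgebra K(1) H(1)])
      fix y assume y: "y \<in> C"
      have "fst k (fst h x) * y = fst k (fst h (x * y))"
        using x y H(1) H(7)[of x y] K(7)[of "fst h x" y] by simp
      also have "\<dots> = fst k x * fst h y"
        using x y H(1) comm[of x y] K(7)[of x "fst h y"] by simp
      also have "\<dots> = fst h (fst k x) * y"
        using x y K(1) comm[of "fst k x" y] H(7)[of "fst k x" y] by simp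
      finally show "fst k (fst h x) * y = fst h (fst k x) * y" .
    qed
    then show ?thesis
      by (simp add: True act_\<iota> h k)
  next
    case False
    then show ?thesis
      by (simp add: act_\<iota> h k)
  qed
qed

end

section \<open>\<open>*\<close>-homomorphisms on \<open>C\<^sub>0((0,1])\<close>\<close>

definition C0_hom :: "((real \<Rightarrow> complex) \<Rightarrow> 'm::unital_cstar_algebra) \<Rightarrow> bool" where
  "C0_hom \<Psi> \<longleftrightarrow>
     (\<forall>f\<in>C0_01. \<forall>g\<in>C0_01. \<Psi> (\<lambda>t. f t + g t) = \<Psi> f + \<Psi> g \<and> \<Psi> (\<lambda>t. f t * g t) = \<Psi> f * \<Psi> g) \<and>
     (\<forall>f\<in>C0_01. (\<forall>c. \<Psi> (\<lambda>t. c * f t) = c *\<^sub>C \<Psi> f) \<and> \<Psi> (\<lambda>t. cnj (f t)) = adj (\<Psi> f))"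

lemma C0_homD:
  assumes "C0_hom \<Psi>" "f \<in> C0_01"
  shows "g \<in> C0_01 \<Longrightarrow> \<Psi> (\<lambda>t. f t + g t) = \<Psi> f + \<Psi> g"
    "g \<in> C0_01 \<Longrightarrow> \<Psi> (\<lambda>t. f t * g t) = \<Psi> f * \<Psi> g"
    "\<Psi> (\<lambda>t. c * f t) = c *\<^sub>C \<Psi> f" "\<Psi> (\<lambda>t. cnj (f t)) = adj (\<Psi> f)"
  using assms by (auto simp: C0_hom_def)

lemma C0_01_closed:
  assumes "f \<in> C0_01"
  shows "g \<in> C0_01 \<Longrightarrow> (\<lambda>t. f t + g t) \<in> C0_01" "g \<in> C0_01 \<Longrightarrow> (\<lambda>t. f t * g t) \<in> C0_01"
    "(\<lambda>t. c * f t) \<in> C0_01" "(\<lambda>t. cnj (f t)) \<in> C0_01"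
  using assms by (auto simp: C0_01_def intro!: continuous_intros)

lemma id_01_C0_01: "id_01 \<in> C0_01"
proof -
  have "continuous_on {0..1} complex_of_real"
    by (intro continuous_intros)
  then have "continuous_on {0..1} id_01"
    by (rule continuous_on_eq) (auto simp: id_01_def)
  then show ?thesis
    by (auto simp: C0_01_def id_01_def)
qed

lemma C0_01_continuous:
  assumes "f \<in> C0_01"
  shows "continuous_on {-1..1} f"
proof -
  have "continuous_on {-1..0::real} (\<lambda>_. 0::complex)"
    by (rule continuous_on_const)
  then have "continuous_on {-1..0} f"
    by (rule continuous_on_eq) (use assms in \<open>auto simp: C0_01_def\<close>)
  moreover have "continuous_on {0..1} f"
    using assms by (simp add: C0_01_def)
  ultimately have "continuous_on ({-1..0} \<union> {0..1}) f"
    by (intro continuous_on_closed_Un) auto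
  moreover have "{-1..0} \<union> {0..1} = {-1..1::real}"
    by auto
  ultimately show ?thesis
    by simp
qed

text \<open>\<open>C0_01\<close> is a set of functions and not a type, so the argument of
  \<open>star_hom_contractive\<close> is repeated with an explicit quasi square root: for a = |f|^2
  it is sqrt(1 - a^2) - 1, which vanishes wherever f does.\<close>

lemma C0_hom_norm_le_1:
  assumes \<Psi>: "C0_hom \<Psi>" and f: "f \<in> C0_01" and le: "\<And>t. cmod (f t) \<le> 1"
  shows "norm (\<Psi> f) \<le> 1"
proof -
  define r where "r t = (cmod (f t))\<^sup>2" for t
  define b where "b t = complex_of_real (sqrt (1 - (r t)\<^sup>2) - 1)" for t
  define a where "a t = cnj (f t) * f t" for t
  have a_eq: "a t = complex_of_real (r t)" for t
    by (simp only: a_def r_def complex_norm_square mult.commute)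
  have r: "0 \<le> r t" "r t \<le> 1" "(r t)\<^sup>2 \<le> 1" for t
    using le[of t] by (auto simp: r_def power_le_one)
  have a: "a \<in> C0_01"
    unfolding a_def by (intro C0_01_closed f)
  have "continuous_on {0..1} f"
    using f by (simp add: C0_01_def)
  then have b: "b \<in> C0_01"
    using f by (auto simp: b_def r_def C0_01_def intro!: continuous_intros)
  have ab: "a t * a t + (b t * b t + 2 * b t) = 0" for t
  proof -
    have "r t * r t + ((sqrt (1 - (r t)\<^sup>2) - 1) * (sqrt (1 - (r t)\<^sup>2) - 1) + 2 * (sqrt (1 - (r t)\<^sup>2) - 1)) = 0"
      using r(3)[of t] by (simp add: algebra_simps power2_eq_square)
    then show ?thesis
      unfolding a_eq b_def by (metis of_real_0 of_real_add of_real_mult of_real_numeral)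
  qed
  have zero: "\<Psi> (\<lambda>t. 0) = 0"
    using C0_homD(3)[OF \<Psi> f, of 0] by simp
  note cl = C0_01_closed
  have "\<Psi> (\<lambda>t. a t * a t + (b t * b t + 2 * b t)) = \<Psi> a * \<Psi> a + (\<Psi> b * \<Psi> b + 2 *\<^sub>C \<Psi> b)"
    by (simp add: C0_homD(1)[OF \<Psi> cl(2)[OF a a] cl(1)[OF cl(2)[OF b b] cl(3)[OF b]]]
        C0_homD(1)[OF \<Psi> cl(2)[OF b b] cl(3)[OF b]] C0_homD(2)[OF \<Psi> a a] C0_homD(2)[OF \<Psi> b b]
        C0_homD(3)[OF \<Psi> b])
  then have "\<Psi> a * \<Psi> a + \<Psi> b * \<Psi> b + 2 *\<^sub>R \<Psi> b = 0"
    unfolding ab zero using scaleC_of_real[of 2 "\<Psi> b"] by (simp add: add.assoc)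
  moreover have "(\<lambda>t. cnj (a t)) = a" "(\<lambda>t. cnj (b t)) = b"
    by (simp_all add: a_eq b_def fun_eq_iff)
  then have "adj (\<Psi> a) = \<Psi> a" "adj (\<Psi> b) = \<Psi> b"
    using C0_homD(4)[OF \<Psi> a] C0_homD(4)[OF \<Psi> b] by simp_all
  moreover have "\<Psi> a * \<Psi> b = \<Psi> b * \<Psi> a"
    by (simp add: C0_homD(2)[OF \<Psi> a b, symmetric] C0_homD(2)[OF \<Psi> b a, symmetric] mult.commute)
  ultimately have "norm (\<Psi> a) \<le> 1"
    by (intro norm_le_one_if_quasi_sqrt)
  moreover have "\<Psi> a = adj (\<Psi> f) * \<Psi> f"
    unfolding a_def by (simp add: C0_homD(2)[OF \<Psi> cl(4)[OF f] f] C0_homD(4)[OF \<Psi> f])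
  ultimately show ?thesis
    by (simp add: cstar_identity abs_square_le_1)
qed

lemma C0_hom_norm_le:
  assumes \<Psi>: "C0_hom \<Psi>" and f: "f \<in> C0_01" and le: "\<And>t. cmod (f t) \<le> B" and B: "0 < B"
  shows "norm (\<Psi> f) \<le> B"
proof -
  have "norm (\<Psi> (\<lambda>t. complex_of_real (1 / B) * f t)) \<le> 1"
    using le B by (intro C0_hom_norm_le_1[OF \<Psi> C0_01_closed(3)[OF f]]) (simp add: norm_mult norm_divide divide_le_eq)
  then show ?thesis
    unfolding C0_homD(3)[OF \<Psi> f] scaleC_of_real using B by (simp add: divide_le_eq)
qed

definition poly_01 :: "complex poly \<Rightarrow> real \<Rightarrow> complex" where
  "poly_01 p t = id_01 t * poly p (complex_of_real t)"

lemma poly_01_C0_01: "poly_01 p \<in> C0_01"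
  using id_01_C0_01 by (auto simp: poly_01_def C0_01_def intro!: continuous_intros)

text \<open>Since f(0) = 0, a polynomial close to f has a small constant term. Dropping it costs
  another e / 2 and leaves a multiple of t.\<close>

lemma poly_01_dense:
  assumes f: "f \<in> C0_01" and "0 < e"
  shows "\<exists>p. \<forall>t. cmod (f t - poly_01 p t) \<le> e"
proof -
  obtain P where "poly_approx P f"
    using poly_approx_exists[OF C0_01_continuous[OF f]] by blast
  then obtain q where q: "\<And>t. t \<in> {-1..1} \<Longrightarrow> cmod (poly q (complex_of_real t) - f t) < e / 2"
    using \<open>0 < e\<close> unfolding poly_approx_def uniform_limit_sequentially_iff dist_norm
    by (meson half_gt_zero order_refl)
  obtain c p where cp: "q = pCons c p"
    by (cases q)
  have "f 0 = 0"
    using f by (simp add: C0_01_def)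
  then have c: "cmod c < e / 2"
    using q[of 0] by (simp add: cp)
  have "cmod (f t - poly_01 p t) \<le> e" for t
  proof (cases "t \<in> {0<..1}")
    case True
    then have eq: "f t - poly_01 p t = c - (poly q (complex_of_real t) - f t)"
      by (simp add: poly_01_def id_01_def cp)
    show ?thesis
      unfolding eq using True c q[of t]
      by (intro order_trans[OF norm_triangle_ineq4]) simp
  next
    case False
    then have "f t = 0" "poly_01 p t = 0"
      using f unfolding C0_01_def poly_01_def id_01_def by auto
    then show ?thesis
      using \<open>0 < e\<close> by simp
  qed
  then show ?thesis
    by blast
qed

text \<open>Agreement at t spreads to all t p(t) without a unit, through t (c + t p) = c t + t (t
  p), and then to f by density, as both maps are contractive.\<close>

lemma C0_hom_eqI:
  assumes \<Psi>: "C0_hom \<Psi>" and \<Psi>': "C0_hom \<Psi>'" and id: "\<Psi> id_01 = \<Psi>' id_01" and f: "f \<in> C0_01"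
  shows "\<Psi> f = \<Psi>' f"
proof -
  have poly: "\<Psi> (poly_01 p) = \<Psi>' (poly_01 p)" for p
  proof (induction p)
    case 0
    then show ?case
      using C0_homD(3)[OF \<Psi> f, of 0] C0_homD(3)[OF \<Psi>' f, of 0] by (simp add: poly_01_def)
  next
    case (pCons c p)
    have eq: "poly_01 (pCons c p) = (\<lambda>t. c * id_01 t + id_01 t * poly_01 p t)"
      by (auto simp: poly_01_def id_01_def fun_eq_iff algebra_simps)
    have "\<Phi> (poly_01 (pCons c p)) = c *\<^sub>C \<Phi> id_01 + \<Phi> id_01 * \<Phi> (poly_01 p)" if \<Phi>: "C0_hom \<Phi>" for \<Phi> :: "(real \<Rightarrow> complex) \<Rightarrow> 'a"
      unfolding eq
      using C0_homD(1)[OF \<Phi> C0_01_closed(3)[OF id_01_C0_01, of c]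
          C0_01_closed(2)[OF id_01_C0_01 poly_01_C0_01[of p]]]
        C0_homD(2)[OF \<Phi> id_01_C0_01 poly_01_C0_01[of p]] C0_homD(3)[OF \<Phi> id_01_C0_01, of c]
      by simp
    from this[OF \<Psi>] this[OF \<Psi>'] show ?case
      by (simp add: pCons.IH id)
  qed
  have "norm (\<Psi> f - \<Psi>' f) \<le> 0"
  proof (rule field_le_epsilon)
    fix e :: real assume "0 < e"
    then obtain p where p: "\<And>t. cmod (f t - poly_01 p t) \<le> e / 2"
      using poly_01_dense[OF f, of "e / 2"] by auto
    define g where "g t = f t + (- 1) * poly_01 p t" for t
    have g: "g \<in> C0_01"
      unfolding g_def by (intro C0_01_closed poly_01_C0_01 f)
    have le: "norm (\<Phi> g) \<le> e / 2" if "C0_hom \<Phi>" for \<Phi> :: "(real \<Rightarrow> complex) \<Rightarrow> 'a"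
      using \<open>0 < e\<close> p by (intro C0_hom_norm_le[OF that g]) (auto simp: g_def)
    have "\<Phi> g = \<Phi> f - \<Phi> (poly_01 p)" if "C0_hom \<Phi>" for \<Phi> :: "(real \<Rightarrow> complex) \<Rightarrow> 'a"
      unfolding g_def
      using C0_homD(1)[OF that f C0_01_closed(3)[OF poly_01_C0_01], of "- 1" p]
        C0_homD(3)[OF that poly_01_C0_01, of "- 1" p] by simp
    from this[OF \<Psi>] this[OF \<Psi>'] have "\<Psi> f - \<Psi>' f = \<Psi> g - \<Psi>' g"
      by (simp add: poly)
    then show "norm (\<Psi> f - \<Psi>' f) \<le> 0 + e"
      using le[OF \<Psi>] le[OF \<Psi>'] norm_triangle_ineq4[of "\<Psi> g" "\<Psi>' g"] by simp
  qed
  then show ?thesis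
    by simp
qed

lemma (in self_adjoint_contraction) C0_hom_cfc: "C0_hom (cfc x)"
  unfolding C0_hom_def by (auto intro!: cfc_add cfc_mult cfc_scaleC cfc_cnj C0_01_continuous)

section \<open>Functional calculus in the multiplier algebra\<close>

locale central_positive_contraction = cstar_subalgebra_locale C
  for C :: "'b::cstar_algebra set" +
  fixes h :: "'b centralizer"
  assumes h_in: "h \<in> multipliers C"
    and h_central: "\<And>c. c \<in> C \<Longrightarrow> M_mult h (M_embed C c) = M_mult (M_embed C c) h"
    and h_positive: "M_positive C h"
    and h_contraction: "\<And>x. x \<in> C \<Longrightarrow> norm (fst h x) \<le> norm x"
begin

lemma norm_\<iota>_h: "norm (\<iota> h) \<le> 1"
  by (rule norm_mult_family_le) (auto simp: act_\<iota> h_in h_contraction)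

lemma h_eq_adj_mult:
  obtains k where "\<iota> h = adj k * k" "k * \<iota> h = \<iota> h * k"
proof -
  obtain k where k: "k \<in> multipliers C" "h = M_mult (M_adj k) k"
    using h_positive by (auto simp: M_positive_def)
  have "\<iota> h = adj (\<iota> k) * \<iota> k"
    by (simp add: k(2) \<iota>_simps(2)[OF multipliers_closed(4)[OF k(1)] k(1)] \<iota>_simps(4)[OF k(1)])
  moreover have "\<iota> k * \<iota> h = \<iota> h * \<iota> k"
    using central_multiplier[OF h_in k(1)] h_central by blast
  ultimately show ?thesis
    using that by blast
qed

sublocale self_adjoint_contraction "\<iota> h"
proof
  show "adj (\<iota> h) = \<iota> h"
    by (rule h_eq_adj_mult) (metis adj_adj adj_mult)
qed (rule norm_\<iota>_h)

text \<open>On [-1,1] the function \<open>id_01\<close> is t + max(0, -t), and the second summand is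
  sent to 0.\<close>

lemma cfc_id_01: "cfc (\<iota> h) id_01 = \<iota> h"
proof -
  let ?n = "\<lambda>t. complex_of_real (max 0 (- t))"
  have c: "continuous_on {-1..1} ?n"
    by (intro continuous_intros)
  have "cfc (\<iota> h) ?n = 0"
    by (rule h_eq_adj_mult) (use negative_part_adj_mult_self norm_\<iota>_h in blast)
  moreover have "cfc (\<iota> h) id_01 = cfc (\<iota> h) (\<lambda>t. complex_of_real t + ?n t)"
    by (rule cfc_cong[OF C0_01_continuous[OF id_01_C0_01]]) (auto simp: id_01_def max_def)
  ultimately show ?thesis
    using c by (simp add: cfc_add cfc_id continuous_intros)
qed

lemma cfc_poly_01: "cfc (\<iota> h) (poly_01 p) = \<iota> h * poly_at p (\<iota> h)"
proof -
  have "continuous_on {-1..1} (\<lambda>t. poly p (complex_of_real t))"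
    by (intro continuous_intros)
  then have "cfc (\<iota> h) (\<lambda>t. id_01 t * poly p (complex_of_real t)) = \<iota> h * poly_at p (\<iota> h)"
    by (simp only: cfc_mult C0_01_continuous[OF id_01_C0_01] cfc_id_01 cfc_poly)
  then show ?thesis
    by (simp only: poly_01_def[abs_def])
qed

lemma C0_hom_\<iota>:
  assumes "star_hom_C0_multipliers C \<Phi>"
  shows "C0_hom (\<lambda>f. \<iota> (\<Phi> f))"
  using assms unfolding star_hom_C0_multipliers_def C0_hom_def by (auto simp: \<iota>_simps)

lemma star_hom_component_cfc: "star_hom_C0_multipliers C (\<lambda>f. component (cfc (\<iota> h) f) C)"
  using C0_hom_cfc unfolding star_hom_C0_multipliers_def C0_hom_def
  by (simp add: component_in_multipliers component_simps)

lemma component_cfc_id_01: "component (cfc (\<iota> h) id_01) C = h"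
  by (simp add: cfc_id_01 component_\<iota> h_in)

lemma \<iota>_star_hom_eq_cfc:
  assumes "star_hom_C0_multipliers C \<Phi>" "\<Phi> id_01 = h" "f \<in> C0_01"
  shows "\<iota> (\<Phi> f) = cfc (\<iota> h) f"
  using C0_hom_eqI[OF C0_hom_\<iota>[OF assms(1)] C0_hom_cfc _ assms(3)] by (simp add: assms(2) cfc_id_01)

text \<open>A homomorphism in the description may take any values outside \<open>C0_01\<close>, so
  it is not unique as a function, but its value at f is.\<close>

lemma M_cfc_eq:
  assumes f: "f \<in> C0_01"
  shows "M_cfc C f h = component (cfc (\<iota> h) f) C"
  unfolding M_cfc_def
proof (rule the_equality)
  show "\<exists>\<Phi>. star_hom_C0_multipliers C \<Phi> \<and> \<Phi> id_01 = h \<and> component (cfc (\<iota> h) f) C = \<Phi> f"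
    using star_hom_component_cfc component_cfc_id_01 by blast
next
  fix m assume "\<exists>\<Phi>. star_hom_C0_multipliers C \<Phi> \<and> \<Phi> id_01 = h \<and> m = \<Phi> f"
  then obtain \<Phi> where \<Phi>: "star_hom_C0_multipliers C \<Phi>" "\<Phi> id_01 = h" "m = \<Phi> f"
    by blast
  then have "m \<in> multipliers C"
    using f by (auto simp: star_hom_C0_multipliers_def)
  then show "m = component (cfc (\<iota> h) f) C"
    using \<iota>_star_hom_eq_cfc[OF \<Phi>(1,2) f] \<Phi>(3) by (metis component_\<iota>)
qed

lemma M_cfc_in_multipliers: "f \<in> C0_01 \<Longrightarrow> M_cfc C f h \<in> multipliers C"
  by (simp add: M_cfc_eq component_in_multipliers)

lemma \<iota>_M_cfc: "f \<in> C0_01 \<Longrightarrow> \<iota> (M_cfc C f h) = cfc (\<iota> h) f"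
  using \<iota>_star_hom_eq_cfc[OF star_hom_component_cfc component_cfc_id_01] by (simp add: M_cfc_eq)

end

section \<open>Functional calculus of order zero maps\<close>

locale order_zero_structure = central_positive_contraction C h
  for C :: "'b::cstar_algebra set" and h +
  fixes \<phi> :: "'a::cstar_algebra \<Rightarrow> 'b" and \<pi> :: "'a \<Rightarrow> 'b centralizer"
  assumes \<phi>_in: "\<phi> a \<in> C"
    and \<pi>_hom: "star_hom_multipliers C \<pi>"
    and \<pi>_h_commute: "M_mult (\<pi> a) h = M_mult h (\<pi> a)"
    and \<pi>_h: "M_mult (\<pi> a) h = M_embed C (\<phi> a)"
begin

definition \<rho> :: "'a \<Rightarrow> 'b mult_family" where
  "\<rho> a = \<iota> (\<pi> a)"

lemma \<pi>_in: "\<pi> a \<in> multipliers C"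
  using \<pi>_hom by (simp add: star_hom_multipliers_def)

lemma \<rho>_hom:
  "\<rho> (a + b) = \<rho> a + \<rho> b" "\<rho> (c *\<^sub>C a) = c *\<^sub>C \<rho> a" "\<rho> (a * b) = \<rho> a * \<rho> b"
  "\<rho> (adj a) = adj (\<rho> a)"
  using \<pi>_hom by (simp_all add: star_hom_multipliers_def \<rho>_def \<iota>_simps)

lemma norm_\<rho>_le: "norm (\<rho> a) \<le> norm a"
  by (rule star_hom_contractive) (rule \<rho>_hom)+

lemma h_\<rho>: "\<iota> h * \<rho> a = emb (\<phi> a)"
  unfolding \<rho>_def emb_def by (simp add: \<iota>_simps(2)[OF h_in \<pi>_in, symmetric] \<pi>_h_commute[symmetric] \<pi>_h)

lemma \<rho>_h: "\<rho> a * \<iota> h = \<iota> h * \<rho> a"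
  by (simp add: \<rho>_def \<iota>_simps(2)[OF h_in \<pi>_in, symmetric] \<iota>_simps(2)[OF \<pi>_in h_in, symmetric] \<pi>_h_commute)

lemma cfc_\<rho>_commute: "f \<in> C0_01 \<Longrightarrow> \<rho> a * cfc (\<iota> h) f = cfc (\<iota> h) f * \<rho> a"
  by (rule cfc_commute[OF C0_01_continuous \<rho>_h])

text \<open>For \<open>f = t p(t)\<close> we have \<open>f(h) \<pi>(a) = p(h) \<phi>(a)\<close>; these \<open>f\<close> are dense.\<close>

lemma cfc_\<rho>_in:
  assumes f: "f \<in> C0_01"
  shows "cfc (\<iota> h) f * \<rho> a \<in> emb ` C"
proof -
  have "cfc (\<iota> h) f * \<rho> a \<in> closure (emb ` C)"
    unfolding closure_approachable
  proof (intro allI impI)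
    fix e :: real assume "0 < e"
    have pos: "0 < 1 + norm (\<rho> a)"
      using norm_ge_zero[of "\<rho> a"] by linarith
    define d where "d = e / (1 + norm (\<rho> a))"
    have "0 < d"
      using \<open>0 < e\<close> pos by (simp add: d_def)
    then obtain p where p: "\<And>t. cmod (f t - poly_01 p t) \<le> d"
      using poly_01_dense[OF f] by blast
    have g: "(\<lambda>t. f t + (- 1) * poly_01 p t) \<in> C0_01"
      by (intro C0_01_closed f poly_01_C0_01)
    have "cfc (\<iota> h) (\<lambda>t. f t + (- 1) * poly_01 p t) = cfc (\<iota> h) f - cfc (\<iota> h) (poly_01 p)"
      using C0_homD(1)[OF C0_hom_cfc f C0_01_closed(3)[OF poly_01_C0_01], of "- 1" p]
        C0_homD(3)[OF C0_hom_cfc poly_01_C0_01, of "- 1" p] by simp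
    moreover have "norm (cfc (\<iota> h) (\<lambda>t. f t + (- 1) * poly_01 p t)) \<le> d"
      using p by (intro norm_cfc_le C0_01_continuous[OF g]) simp
    ultimately have le: "norm (cfc (\<iota> h) (poly_01 p) - cfc (\<iota> h) f) \<le> d"
      by (simp add: norm_minus_commute)
    have "cfc (\<iota> h) (poly_01 p) * \<rho> a = poly_at p (\<iota> h) * (\<iota> h * \<rho> a)"
      by (simp add: cfc_poly_01 poly_at_commute mult.assoc[symmetric])
    also have "\<dots> \<in> emb ` C"
      by (simp add: h_\<rho> mult_emb \<phi>_in)
    finally have "cfc (\<iota> h) (poly_01 p) * \<rho> a \<in> emb ` C" .
    moreover have "dist (cfc (\<iota> h) (poly_01 p) * \<rho> a) (cfc (\<iota> h) f * \<rho> a) < e"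
    proof -
      have "norm ((cfc (\<iota> h) (poly_01 p) - cfc (\<iota> h) f) * \<rho> a) \<le> d * norm (\<rho> a)"
        by (rule order_trans[OF norm_mult_ineq mult_right_mono[OF le norm_ge_zero]])
      also have "\<dots> < d * (1 + norm (\<rho> a))"
        using \<open>0 < d\<close> by simp
      also have "\<dots> = e"
        using pos by (simp add: d_def)
      finally show ?thesis
        by (simp add: dist_norm left_diff_distrib)
    qed
    ultimately show "\<exists>y\<in>emb ` C. dist y (cfc (\<iota> h) f * \<rho> a) < e"
      by blast
  qed
  then show ?thesis
    by (simp add: closure_closed[OF closed_emb])
qed

text \<open>This membership gives the inverse in \<open>order_zero_calculus\<close> its
  meaning.\<close>

lemma M_mult_cfc_in:
  assumes f: "f \<in> C0_01"
  shows "M_mult (M_cfc C f h) (\<pi> a) \<in> M_embed C ` C"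
proof -
  obtain c where c: "c \<in> C" "cfc (\<iota> h) f * \<rho> a = emb c"
    using cfc_\<rho>_in[OF f, of a] by blast
  have "component (cfc (\<iota> h) f * \<rho> a) C = M_mult (M_cfc C f h) (\<pi> a)"
    by (simp add: component_simps M_cfc_eq[OF f] \<rho>_def component_\<iota> \<pi>_in)
  moreover have "component (emb c) C = M_embed C c"
    by (simp add: emb_def component_\<iota> M_embed_in_multipliers c(1))
  ultimately show ?thesis
    using c by (metis imageI)
qed

abbreviation \<F> :: "(real \<Rightarrow> complex) \<Rightarrow> 'a \<Rightarrow> 'b" where
  "\<F> f \<equiv> order_zero_calculus C f h \<pi>"

lemma calculus_in: "f \<in> C0_01 \<Longrightarrow> \<F> f a \<in> C"
  unfolding order_zero_calculus_def by (rule inv_into_into[OF M_mult_cfc_in])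

text \<open>As \<open>emb\<close> is injective on C, identities for f(\<phi>) can be checked on f(h)
  \<rho>(a).\<close>

lemma emb_calculus:
  assumes f: "f \<in> C0_01"
  shows "emb (\<F> f a) = cfc (\<iota> h) f * \<rho> a"
proof -
  have "M_embed C (\<F> f a) = M_mult (M_cfc C f h) (\<pi> a)"
    unfolding order_zero_calculus_def by (rule f_inv_into_f[OF M_mult_cfc_in[OF f]])
  then show ?thesis
    by (simp add: emb_def \<iota>_simps(2)[OF M_cfc_in_multipliers[OF f] \<pi>_in] \<iota>_M_cfc[OF f] \<rho>_def)
qed

section \<open>Algebraic rules for the map f(\<phi>)\<close>

lemma calculus_add:
  assumes f: "f \<in> C0_01"
  shows "\<F> f (a + b) = \<F> f a + \<F> f b"
proof -
  have "emb (\<F> f (a + b)) = emb (\<F> f a + \<F> f b)"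
    by (simp add: emb_add calculus_in f emb_calculus \<rho>_hom distrib_left)
  then show ?thesis
    by (simp add: emb_eq_iff calculus_in f cstar_subalgebraD[OF subalgebra])
qed

lemma calculus_scaleC:
  assumes f: "f \<in> C0_01"
  shows "\<F> f (c *\<^sub>C a) = c *\<^sub>C \<F> f a"
proof -
  have "emb (\<F> f (c *\<^sub>C a)) = emb (c *\<^sub>C \<F> f a)"
    by (simp add: emb_scaleC calculus_in f emb_calculus \<rho>_hom scaleC_mult_right)
  then show ?thesis
    by (simp add: emb_eq_iff calculus_in f cstar_subalgebraD[OF subalgebra])
qed

lemma calculus_zero: "f \<in> C0_01 \<Longrightarrow> \<F> f 0 = 0"
  using calculus_scaleC[of f 0 0] by simp

lemma calculus_sum: "f \<in> C0_01 \<Longrightarrow> \<F> f (\<Sum>i\<in>I. a i) = (\<Sum>i\<in>I. \<F> f (a i))"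
  by (induction I rule: infinite_finite_induct) (simp_all add: calculus_zero calculus_add)

lemma calculus_adj:
  assumes f: "f \<in> C0_01"
  shows "adj (\<F> f a) = \<F> (\<lambda>t. cnj (f t)) (adj a)"
proof -
  note g = C0_01_closed(4)[OF f]
  have "emb (adj (\<F> f a)) = emb (\<F> (\<lambda>t. cnj (f t)) (adj a))"
    by (simp add: emb_adj calculus_in f g emb_calculus \<rho>_hom adj_mult cfc_cnj C0_01_continuous
        flip: cfc_\<rho>_commute)
  then show ?thesis
    by (simp add: emb_eq_iff calculus_in f g cstar_subalgebraD[OF subalgebra])
qed

text \<open>The element g(h) commutes with \<rho>(a), so the calculus is multiplicative jointly in
  the function and in the algebra element.\<close>

lemma calculus_mult:
  assumes f: "f \<in> C0_01" and g: "g \<in> C0_01"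
  shows "\<F> f a * \<F> g b = \<F> (\<lambda>t. f t * g t) (a * b)"
proof -
  note fg = C0_01_closed(2)[OF f g]
  have "emb (\<F> f a * \<F> g b) = cfc (\<iota> h) f * (\<rho> a * cfc (\<iota> h) g) * \<rho> b"
    by (simp add: emb_mult calculus_in f g emb_calculus mult.assoc)
  also have "\<dots> = emb (\<F> (\<lambda>t. f t * g t) (a * b))"
    by (simp add: cfc_\<rho>_commute g emb_calculus fg cfc_mult f C0_01_continuous \<rho>_hom mult.assoc)
  finally show ?thesis
    by (simp add: emb_eq_iff calculus_in f g fg cstar_subalgebraD[OF subalgebra])
qed

text \<open>If y is a square root of the matrix a, then g(\<phi>) applied to the entries of y, with
  g the square root of f, is one of the image matrix, and its entries lie in C.\<close>

lemma completely_positive_calculus: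
  assumes f: "f \<in> C0_01" and nonneg: "\<And>t. f t \<in> \<real>\<^sub>\<ge>\<^sub>0"
  shows "completely_positive C (\<F> f)"
proof -
  define g where "g t = complex_of_real (sqrt (Re (f t)))" for t
  have g: "g \<in> C0_01"
    using f by (auto simp: g_def C0_01_def intro!: continuous_intros)
  have f_eq: "f = (\<lambda>t. cnj (g t) * g t)"
  proof
    fix t
    obtain r where "f t = complex_of_real r" "0 \<le> r"
      using nonneg[of t] by (auto elim: nonneg_Reals_cases)
    then show "f t = cnj (g t) * g t"
      by (simp add: g_def flip: of_real_mult)
  qed
  have sq: "\<F> f (adj x * y) = adj (\<F> g x) * \<F> g y" for x y
    by (simp add: calculus_adj calculus_mult g C0_01_closed(4)[OF g] flip: f_eq)
  have "mat_positive C n (\<lambda>i j. \<F> f (a i j))" if a: "mat_positive UNIV n a" for n a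
  proof -
    obtain y where y: "\<And>i j. i < n \<Longrightarrow> j < n \<Longrightarrow> a i j = (\<Sum>k<n. adj (y k i) * y k j)"
      using a unfolding mat_positive_def by blast
    have "\<F> f (a i j) = (\<Sum>k<n. adj (\<F> g (y k i)) * \<F> g (y k j))" if "i < n" "j < n" for i j
      by (simp add: y[OF that] calculus_sum f sq)
    then show ?thesis
      unfolding mat_positive_def by (intro exI[of _ "\<lambda>i j. \<F> g (y i j)"]) (simp add: calculus_in g)
  qed
  then show ?thesis
    by (simp add: completely_positive_def clinear_on_def calculus_in calculus_add calculus_scaleC f)
qed

text \<open>Each product in \<open>orthogonal_elems\<close> becomes the value of a calculus at the
  matching product of a and b, hence at 0.\<close>

lemma order_zero_calculus:
  assumes f: "f \<in> C0_01"
  shows "order_zero (\<F> f)"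
proof -
  note g = C0_01_closed(4)[OF f]
  have "orthogonal_elems (\<F> f a) (\<F> f b)" if "orthogonal_elems a b" for a b
    using that unfolding orthogonal_elems_def
    by (simp add: calculus_adj calculus_mult f g calculus_zero C0_01_closed(2))
  then show ?thesis
    by (simp add: order_zero_def)
qed

lemma contractive_calculus:
  assumes f: "f \<in> C0_01" and le: "\<And>t. cmod (f t) \<le> 1"
  shows "contractive (\<F> f)"
proof -
  have "norm (\<F> f a) \<le> norm a" for a
  proof -
    have "norm (\<F> f a) \<le> norm (cfc (\<iota> h) f) * norm (\<rho> a)"
      using norm_mult_ineq[of "cfc (\<iota> h) f" "\<rho> a"]
      by (simp add: emb_calculus[OF f, symmetric] norm_emb calculus_in f)
    also have "\<dots> \<le> 1 * norm a"
      using le by (intro mult_mono norm_cfc_le C0_01_continuous[OF f] norm_\<rho>_le) auto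
    finally show ?thesis
      by simp
  qed
  then show ?thesis
    by (simp add: contractive_def)
qed

end

lemma cstar_generated:
  shows "cstar_subalgebra (cstar_generated X)" "X \<subseteq> cstar_generated X"
proof -
  have "cstar_subalgebra (\<Inter>T)" if "\<And>S. S \<in> T \<Longrightarrow> cstar_subalgebra S" for T :: "'a set set"
    using that unfolding cstar_subalgebra_def by (auto intro: closed_Inter)
  then show "cstar_subalgebra (cstar_generated X)"
    unfolding cstar_generated_def by - (rule hull_in; blast)
  show "X \<subseteq> cstar_generated X"
    unfolding cstar_generated_def by (rule hull_subset)
qed

theorem corollary3p2:
  fixes \<phi> :: "'a::cstar_algebra \<Rightarrow> 'b::cstar_algebra"
    and \<pi> :: "'a \<Rightarrow> 'b centralizer"
    and h :: "'b centralizer"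
    and f :: "real \<Rightarrow> complex"
    and C :: "'b set"
  assumes "completely_positive UNIV \<phi>" and "contractive \<phi>" and "order_zero \<phi>"
    and "f \<in> C0_01" and "\<And>t. f t \<in> \<real>\<^sub>\<ge>\<^sub>0"
    and "C = cstar_generated (range \<phi>)"
    and "h \<in> multipliers C" and "\<And>c. c \<in> C \<Longrightarrow> M_mult h (M_embed C c) = M_mult (M_embed C c) h"
    and "M_positive C h" and "M_norm C h = onorm \<phi>"
    and "star_hom_multipliers C \<pi>" and "\<And>a. M_mult (\<pi> a) h = M_mult h (\<pi> a)"
    and "\<And>a. M_mult (\<pi> a) h = M_embed C (\<phi> a)"
    and "\<And>u. (\<And>a. u * a = a \<and> a * u = a) \<Longrightarrow> h = M_embed C (\<phi> u)"
  shows "(\<forall>a. M_mult (M_cfc C f h) (\<pi> a) \<in> M_embed C ` C) \<and>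
         completely_positive C (order_zero_calculus C f h \<pi>) \<and>
         order_zero (order_zero_calculus C f h \<pi>) \<and>
         ((\<forall>t. cmod (f t) \<le> 1) \<longrightarrow> contractive (order_zero_calculus C f h \<pi>))"
proof -
  have C: "cstar_subalgebra C" "range \<phi> \<subseteq> C"
    unfolding assms(6) by (rule cstar_generated)+
  \<comment> \<open>Together with the equality of norms this makes h a contraction, as its calculus
    on [-1,1] requires.\<close>
  have "onorm \<phi> \<le> 1"
    using assms(2) by (intro onorm_bound) (simp_all add: contractive_def)
  have h_le: "norm (fst h x) \<le> norm x" if x: "x \<in> C" for x
  proof -
    obtain K where K: "centralizer_pair C (fst h) (snd h)" "0 \<le> K" "\<And>x. norm (fst h x) \<le> K * norm x"
      using assms(7) unfolding multipliers_iff[OF C(1)] by blast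
    \<comment> \<open>The supremum in \<open>M_norm\<close> dominates the quotients only because
      they are bounded, which holds for a multiplier.\<close>
    have "bdd_above ((\<lambda>x. norm (fst h x) / norm x) ` C)"
    proof (rule bdd_aboveI2)
      show "norm (fst h y) / norm y \<le> K" for y
        using K by (cases "y = 0") (auto simp: divide_le_eq)
    qed
    then have "norm (fst h x) / norm x \<le> M_norm C h"
      unfolding M_norm_def using x by (intro cSUP_upper)
    also have "\<dots> \<le> 1"
      using \<open>onorm \<phi> \<le> 1\<close> assms(10) by simp
    \<comment> \<open>For x = 0 the quotient carries no information, and the bound K is
      used.\<close>
    finally show ?thesis
      using K(3)[of x] by (cases "x = 0") (simp_all add: divide_le_eq)
  qed
  interpret order_zero_structure C h \<phi> \<pi>
    by unfold_locales (use C(2) in \<open>auto intro: C(1) assms h_le\<close>)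
  show ?thesis
    using M_mult_cfc_in completely_positive_calculus order_zero_calculus contractive_calculus assms(4,5)
    by blast
qed

end
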